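(* Let $X$ be a Hilbert space, $A\subset B(X)$ a $C^*$-subalgebra, $M$ the strong-operator closure of $A$ with $\mathrm{id}_X\in M$, and $H$ a Hilbert $A$-module. Then for every $\xi\in H\bullet M$ there is a net $\{x_\alpha\}$ in $H$ (embedded in $H\bullet M$ via $x\mapsto x\bullet1$) with $\|x_\alpha\|\le\|\xi\|$ for all $\alpha$ such that $$\lim_\alpha\|\langle\xi-x_\alpha,\xi-x_\alpha\rangle v\|=0\quad\text{for all } v\in X.$$ In particular, the unit ball of $H$ is dense in the unit ball of $H\bullet M$ in the topology $\mathcal T_s$ in which a net $z_\alpha$ converges to $\xi$ iff $\|\langle\xi-z_\alpha,\xi-z_\alpha\rangle v\|\to0$ for all $v\in X$.
   Context: Hilbert modules are right modules with inner product linear in the second variable. $H\bullet M$ is the Hilbert $M$-module obtained by completing the algebraic tensor product $H\otimes M$ (action $(h\otimes a)b=h\otimes ab$, inner product $\langle\sum h_i\otimes a_i,\sum x_j\otimes b_j\rangle=\sum a_i^*\langle h_i,x_j\rangle b_j$) modulo zero-length vectors; $x\bullet b$ is the class of $x\otimes b$. Inner products in $H\bullet M$ lie in $M\subset B(X)$. *)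

theory Defs
  imports "HOL-Analysis.Analysis"
begin

definition cvs :: "(complex \<Rightarrow> 'a::ab_group_add \<Rightarrow> 'a) \<Rightarrow> bool" where
  "cvs sc \<longleftrightarrow>
     (\<forall>c x y. sc c (x + y) = sc c x + sc c y) \<and>
     (\<forall>c d x. sc (c + d) x = sc c x + sc d x) \<and>
     (\<forall>c d x. sc c (sc d x) = sc (c * d) x) \<and>
     (\<forall>x. sc 1 x = x)"

definition complete_wrt :: "('a \<Rightarrow> 'a \<Rightarrow> real) \<Rightarrow> bool" where
  "complete_wrt d \<longleftrightarrow>
     (\<forall>s :: nat \<Rightarrow> 'a.
        (\<forall>e>0. \<exists>N. \<forall>m\<ge>N. \<forall>n\<ge>N. d (s m) (s n) < e) \<longrightarrow>
        (\<exists>l. \<forall>e>0. \<exists>N. \<forall>n\<ge>N. d (s n) l < e))"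

definition hnorm :: "('x \<Rightarrow> 'x \<Rightarrow> complex) \<Rightarrow> 'x \<Rightarrow> real" where
  "hnorm ip x = sqrt (Re (ip x x))"

definition hilbert_space ::
  "(complex \<Rightarrow> 'x::ab_group_add \<Rightarrow> 'x) \<Rightarrow> ('x \<Rightarrow> 'x \<Rightarrow> complex) \<Rightarrow> bool" where
  "hilbert_space sc ip \<longleftrightarrow>
     cvs sc \<and>
     (\<forall>x y z. ip x (y + z) = ip x y + ip x z) \<and>
     (\<forall>c x y. ip x (sc c y) = c * ip x y) \<and>
     (\<forall>x y. ip y x = cnj (ip x y)) \<and>
     (\<forall>x. Re (ip x x) \<ge> 0) \<and>
     (\<forall>x. ip x x = 0 \<longrightarrow> x = 0) \<and>
     complete_wrt (\<lambda>x y. hnorm ip (x - y))"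

definition bounded_op ::
  "(complex \<Rightarrow> 'x::ab_group_add \<Rightarrow> 'x) \<Rightarrow> ('x \<Rightarrow> 'x \<Rightarrow> complex) \<Rightarrow> ('x \<Rightarrow> 'x) \<Rightarrow> bool" where
  "bounded_op sc ip T \<longleftrightarrow>
     (\<forall>x y. T (x + y) = T x + T y) \<and>
     (\<forall>c x. T (sc c x) = sc c (T x)) \<and>
     (\<exists>K. \<forall>x. hnorm ip (T x) \<le> K * hnorm ip x)"

definition opnorm :: "('x \<Rightarrow> 'x \<Rightarrow> complex) \<Rightarrow> ('x \<Rightarrow> 'x) \<Rightarrow> real" where
  "opnorm ip T = Sup {hnorm ip (T x) | x. hnorm ip x \<le> 1}"

definition adj :: "('x \<Rightarrow> 'x \<Rightarrow> complex) \<Rightarrow> ('x \<Rightarrow> 'x) \<Rightarrow> ('x \<Rightarrow> 'x)" where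
  "adj ip T = (THE S. \<forall>x y. ip (T x) y = ip x (S y))"

definition positive_op :: "('x \<Rightarrow> 'x \<Rightarrow> complex) \<Rightarrow> ('x \<Rightarrow> 'x) \<Rightarrow> bool" where
  "positive_op ip T \<longleftrightarrow> (\<forall>v. Im (ip v (T v)) = 0 \<and> Re (ip v (T v)) \<ge> 0)"

definition cstar_subalg ::
  "(complex \<Rightarrow> 'x::ab_group_add \<Rightarrow> 'x) \<Rightarrow> ('x \<Rightarrow> 'x \<Rightarrow> complex) \<Rightarrow> ('x \<Rightarrow> 'x) set \<Rightarrow> bool" where
  "cstar_subalg sc ip A \<longleftrightarrow>
     A \<subseteq> Collect (bounded_op sc ip) \<and>
     (\<lambda>v. 0) \<in> A \<and>
     (\<forall>S\<in>A. \<forall>T\<in>A. (\<lambda>v. S v + T v) \<in> A) \<and>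
     (\<forall>c. \<forall>T\<in>A. (\<lambda>v. sc c (T v)) \<in> A) \<and>
     (\<forall>S\<in>A. \<forall>T\<in>A. S \<circ> T \<in> A) \<and>
     (\<forall>T\<in>A. adj ip T \<in> A) \<and>
     (\<forall>T. bounded_op sc ip T \<longrightarrow>
        (\<forall>e>0. \<exists>a\<in>A. opnorm ip (\<lambda>v. T v - a v) < e) \<longrightarrow> T \<in> A)"

definition sot_closure ::
  "(complex \<Rightarrow> 'x::ab_group_add \<Rightarrow> 'x) \<Rightarrow> ('x \<Rightarrow> 'x \<Rightarrow> complex) \<Rightarrow> ('x \<Rightarrow> 'x) set \<Rightarrow> ('x \<Rightarrow> 'x) set" where
  "sot_closure sc ip A =
     {T. bounded_op sc ip T \<and>
         (\<forall>V e. finite V \<longrightarrow> e > 0 \<longrightarrow> (\<exists>a\<in>A. \<forall>v\<in>V. hnorm ip (T v - a v) < e))}"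

definition mnorm ::
  "('x \<Rightarrow> 'x \<Rightarrow> complex) \<Rightarrow> ('h \<Rightarrow> 'h \<Rightarrow> ('x \<Rightarrow> 'x)) \<Rightarrow> 'h \<Rightarrow> real" where
  "mnorm ip hip x = sqrt (opnorm ip (hip x x))"

definition hilbert_module ::
  "(complex \<Rightarrow> 'x::ab_group_add \<Rightarrow> 'x) \<Rightarrow> ('x \<Rightarrow> 'x \<Rightarrow> complex) \<Rightarrow> ('x \<Rightarrow> 'x) set \<Rightarrow>
   (complex \<Rightarrow> 'h::ab_group_add \<Rightarrow> 'h) \<Rightarrow> ('h \<Rightarrow> ('x \<Rightarrow> 'x) \<Rightarrow> 'h) \<Rightarrow>
   ('h \<Rightarrow> 'h \<Rightarrow> ('x \<Rightarrow> 'x)) \<Rightarrow> bool" where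
  "hilbert_module sc ip B hsc act hip \<longleftrightarrow>
     cvs hsc \<and>
     (\<forall>x y a. a \<in> B \<longrightarrow> act (x + y) a = act x a + act y a) \<and>
     (\<forall>x a b. a \<in> B \<longrightarrow> b \<in> B \<longrightarrow> act x (\<lambda>v. a v + b v) = act x a + act x b) \<and>
     (\<forall>x a b. a \<in> B \<longrightarrow> b \<in> B \<longrightarrow> act x (a \<circ> b) = act (act x a) b) \<and>
     (\<forall>c x a. a \<in> B \<longrightarrow> hsc c (act x a) = act (hsc c x) a) \<and>
     (\<forall>c x a. a \<in> B \<longrightarrow> hsc c (act x a) = act x (\<lambda>v. sc c (a v))) \<and>
     (\<forall>x y. hip x y \<in> B) \<and>
     (\<forall>x y z. hip x (y + z) = (\<lambda>v. hip x y v + hip x z v)) \<and>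
     (\<forall>c x y. hip x (hsc c y) = (\<lambda>v. sc c (hip x y v))) \<and>
     (\<forall>x y a. a \<in> B \<longrightarrow> hip x (act y a) = hip x y \<circ> a) \<and>
     (\<forall>x y. hip y x = adj ip (hip x y)) \<and>
     (\<forall>x. positive_op ip (hip x x)) \<and>
     (\<forall>x. hip x x = (\<lambda>v. 0) \<longrightarrow> x = 0) \<and>
     complete_wrt (\<lambda>x y. mnorm ip hip (x - y))"

text \<open>The interior tensor product H \<bullet> M, characterised (up to unitary
isomorphism of Hilbert M-modules) as a Hilbert M-module K together with the
map j x b = x \<bullet> b satisfying the inner product formula
<x \<bullet> a, y \<bullet> b> = a* <x,y> b, such that the finite sums of
elementary tensors are dense in K.\<close>
definition interior_tensor ::
  "(complex \<Rightarrow> 'x::ab_group_add \<Rightarrow> 'x) \<Rightarrow> ('x \<Rightarrow> 'x \<Rightarrow> complex) \<Rightarrow> ('x \<Rightarrow> 'x) set \<Rightarrow>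
   ('h \<Rightarrow> 'h \<Rightarrow> ('x \<Rightarrow> 'x)) \<Rightarrow>
   (complex \<Rightarrow> 'k::ab_group_add \<Rightarrow> 'k) \<Rightarrow> ('k \<Rightarrow> ('x \<Rightarrow> 'x) \<Rightarrow> 'k) \<Rightarrow>
   ('k \<Rightarrow> 'k \<Rightarrow> ('x \<Rightarrow> 'x)) \<Rightarrow> ('h \<Rightarrow> ('x \<Rightarrow> 'x) \<Rightarrow> 'k) \<Rightarrow> bool" where
  "interior_tensor sc ip M hip ksc kact kip j \<longleftrightarrow>
     hilbert_module sc ip M ksc kact kip \<and>
     (\<forall>x y a b. a \<in> M \<longrightarrow> b \<in> M \<longrightarrow>
        kip (j x a) (j y b) = adj ip a \<circ> hip x y \<circ> b) \<and>
     (\<forall>\<xi> e. e > 0 \<longrightarrow>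
        (\<exists>(n::nat) (xs :: nat \<Rightarrow> 'h) (bs :: nat \<Rightarrow> ('x \<Rightarrow> 'x)).
           (\<forall>i<n. bs i \<in> M) \<and>
           mnorm ip kip (\<xi> - (\<Sum>i<n. j (xs i) (bs i))) < e))"

end

theory Submission
  imports Defs "HOL-Library.Function_Algebras"
begin

text \<open>
  This is Kaplansky's argument with the map \<open>g x = 2 (1 + x x*)\<^sup>-\<^sup>1 x\<close>, where \<open>x x*\<close> denotes
  \<open>y \<mapsto> x\<langle>x, y\<rangle>\<close>. Every value of \<open>g\<close> has norm at most \<open>1\<close>, and if \<open>\<parallel>\<xi>\<parallel> < 1\<close> then \<open>\<xi> = g \<eta>\<close> where
  \<open>\<eta>\<close> is the fixed point of the contraction \<open>\<eta> \<mapsto> (\<xi> + \<eta>\<langle>\<eta>, \<xi>\<rangle>) / 2\<close>. Approximating the coefficients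
  of \<open>\<eta>\<close> from \<open>A\<close> gives \<open>x\<close> in \<open>H\<close>, of uncontrolled norm, with both \<open>(x - \<eta>)v\<close> and
  \<open>\<langle>x - \<eta>, \<xi>\<rangle>v\<close> small, and from
  \<open>(1 + x x*)(g x - \<xi>) = 2 (x - \<eta>) - (x - \<eta>)\<langle>\<eta>, \<xi>\<rangle> - x\<langle>x - \<eta>, \<xi>\<rangle>\<close>
  it follows that \<open>g x\<close> is close to \<open>\<xi>\<close> at \<open>v\<close>. All estimates are made in the seminorms
  \<open>\<langle>v, \<langle>x, x\<rangle>v\<rangle>\<^sup>1\<^sup>/\<^sup>2\<close>, and approximate solutions of the two equations suffice, so neither
  square roots nor inverses in the algebras occur.
\<close>

section \<open>Semidefinite real forms: Cauchy-Schwarz and approximate Riesz representation\<close>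

lemma discriminant_le:
  fixes a b c :: real
  assumes "\<And>t. a * t\<^sup>2 + 2 * b * t + c \<ge> 0" and "a \<ge> 0"
  shows "b\<^sup>2 \<le> a * c"
proof (cases "a = 0")
  case True
  have "b = 0"
  proof (rule ccontr)
    assume "b \<noteq> 0"
    \<comment> \<open>The chosen \<open>t\<close> makes \<open>2 * b * t + c\<close> equal to
      -1.\<close>
    then show False
      using assms(1)[of "- (c + 1) / (2 * b)"] True by (simp add: field_simps)
  qed
  then show ?thesis using True by simp
next
  case False
  then have "a > 0" using assms by simp
  have "a * (b / a)\<^sup>2 - 2 * b * (b / a) + c \<ge> 0"
    using assms(1)[of "- b / a"] by simp
  then show ?thesis using \<open>a > 0\<close> by (simp add: field_simps power2_eq_square)
qed

text \<open>Scalars are real and a carrier \<open>S\<close> is kept because one instance is the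
  operator algebra \<open>A\<close>, a set of functions, with a form that involves adjoints and is
  only real bilinear. Degenerate forms are allowed, so no quotient has to be formed.\<close>

locale psd_form =
  fixes S :: "'a::ab_group_add set" and rs :: "real \<Rightarrow> 'a \<Rightarrow> 'a" and \<beta> :: "'a \<Rightarrow> 'a \<Rightarrow> real"
  assumes zero_in: "0 \<in> S"
    and add_in: "\<lbrakk>x \<in> S; y \<in> S\<rbrakk> \<Longrightarrow> x + y \<in> S"
    and diff_in: "\<lbrakk>x \<in> S; y \<in> S\<rbrakk> \<Longrightarrow> x - y \<in> S"
    and rs_in: "x \<in> S \<Longrightarrow> rs r x \<in> S"
    and add_right: "\<lbrakk>x \<in> S; y \<in> S; z \<in> S\<rbrakk> \<Longrightarrow> \<beta> x (y + z) = \<beta> x y + \<beta> x z"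
    and rs_right: "\<lbrakk>x \<in> S; y \<in> S\<rbrakk> \<Longrightarrow> \<beta> x (rs r y) = r * \<beta> x y"
    and sym: "\<lbrakk>x \<in> S; y \<in> S\<rbrakk> \<Longrightarrow> \<beta> x y = \<beta> y x"
    and nonneg: "x \<in> S \<Longrightarrow> \<beta> x x \<ge> 0"
begin

definition sn :: "'a \<Rightarrow> real" where "sn x = sqrt (\<beta> x x)"

lemma add_left: "\<lbrakk>x \<in> S; y \<in> S; z \<in> S\<rbrakk> \<Longrightarrow> \<beta> (x + y) z = \<beta> x z + \<beta> y z"
  using add_right sym add_in by metis

lemma rs_left: "\<lbrakk>x \<in> S; y \<in> S\<rbrakk> \<Longrightarrow> \<beta> (rs r x) y = r * \<beta> x y"
  using rs_right sym rs_in by metis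

lemma diff_right: "\<lbrakk>x \<in> S; y \<in> S; z \<in> S\<rbrakk> \<Longrightarrow> \<beta> x (y - z) = \<beta> x y - \<beta> x z"
  using add_right[of x "y - z" z] diff_in by simp

lemma diff_left: "\<lbrakk>x \<in> S; y \<in> S; z \<in> S\<rbrakk> \<Longrightarrow> \<beta> (x - y) z = \<beta> x z - \<beta> y z"
  using diff_right sym diff_in by metis

lemmas form_simps = add_left add_right rs_left rs_right diff_left diff_right
  add_in diff_in rs_in

lemma sn_nonneg: "x \<in> S \<Longrightarrow> sn x \<ge> 0"
  by (simp add: sn_def nonneg)

lemma sn_sq: "x \<in> S \<Longrightarrow> (sn x)\<^sup>2 = \<beta> x x"
  by (simp add: sn_def nonneg)

lemma sn_zero: "sn 0 = 0"
  using diff_right[of 0 0 0] zero_in by (simp add: sn_def)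

lemma Cauchy_Schwarz_sq:
  assumes "x \<in> S" "y \<in> S"
  shows "(\<beta> x y)\<^sup>2 \<le> \<beta> x x * \<beta> y y"
proof -
  have "\<beta> y y * t\<^sup>2 + 2 * \<beta> x y * t + \<beta> x x \<ge> 0" for t
    using nonneg[of "x + rs t y"] assms sym[of x y]
    by (simp add: form_simps algebra_simps power2_eq_square)
  from discriminant_le[OF this nonneg] assms show ?thesis by (simp add: mult.commute)
qed

lemma Cauchy_Schwarz:
  assumes "x \<in> S" "y \<in> S"
  shows "\<bar>\<beta> x y\<bar> \<le> sn x * sn y"
  using real_sqrt_le_mono[OF Cauchy_Schwarz_sq[OF assms]]
  by (simp add: sn_def real_sqrt_mult)

lemma sn_triangle:
  assumes "x \<in> S" "y \<in> S"
  shows "sn (x + y) \<le> sn x + sn y"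
proof (rule power2_le_imp_le)
  show "(sn (x + y))\<^sup>2 \<le> (sn x + sn y)\<^sup>2"
    using Cauchy_Schwarz[OF assms] sym[OF assms] assms
    by (simp add: sn_sq form_simps power2_sum)
qed (simp add: sn_nonneg assms)

lemma sn_rs: "x \<in> S \<Longrightarrow> sn (rs r x) = \<bar>r\<bar> * sn x"
  by (simp add: sn_def form_simps real_sqrt_mult flip: mult.assoc)

lemma sn_rs_rs_diff:
  assumes "x \<in> S"
  shows "sn (rs k (rs m x) - x) = \<bar>k * m - 1\<bar> * sn x"
proof -
  have "\<beta> (rs k (rs m x) - x) (rs k (rs m x) - x) = (k * m - 1)\<^sup>2 * \<beta> x x"
    using assms by (simp add: form_simps algebra_simps power2_eq_square)
  then show ?thesis by (simp add: sn_def real_sqrt_mult)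
qed

lemma sn_minus_commute:
  assumes "x \<in> S" "y \<in> S"
  shows "sn (x - y) = sn (y - x)"
  using assms by (simp add: sn_def form_simps algebra_simps)

lemma sn_triangle_diff:
  assumes "x \<in> S" "y \<in> S"
  shows "sn (x - y) \<le> sn x + sn y"
  using sn_triangle[of x "0 - y"] assms zero_in diff_in[of 0 y] sn_minus_commute[of 0 y] by simp

text \<open>A minimising sequence of \<open>\<beta> h h - 2 f h\<close> represents the functional \<open>f\<close>; it is Cauchy by
  the parallelogram identity.\<close>

lemma approximate_Riesz:
  fixes f :: "'a \<Rightarrow> real"
  assumes f_add: "\<And>x y. \<lbrakk>x \<in> S; y \<in> S\<rbrakk> \<Longrightarrow> f (x + y) = f x + f y"
    and f_rs: "\<And>r x. x \<in> S \<Longrightarrow> f (rs r x) = r * f x"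
    and f_bound: "\<And>x. x \<in> S \<Longrightarrow> \<bar>f x\<bar> \<le> K * sn x"
  obtains l :: "nat \<Rightarrow> 'a" where "\<And>k. l k \<in> S"
    and "\<And>i k. (sn (l i - l k))\<^sup>2 \<le> 2 / Suc i + 2 / Suc k"
    and "\<And>h. h \<in> S \<Longrightarrow> (\<lambda>k. \<beta> (l k) h) \<longlonglongrightarrow> f h"
proof -
  define \<Phi> where "\<Phi> = (\<lambda>x. \<beta> x x - 2 * f x)"
  \<comment> \<open>With \<open>s = sn x\<close>,
    \<open>\<Phi> x \<ge> s^2 - 2 * K * s = (s - K)^2 - K^2\<close>.\<close>
  have lower: "\<Phi> x \<ge> - K\<^sup>2" if "x \<in> S" for x
    using f_bound[OF that] sn_sq[OF that] zero_le_power2[of "sn x - K"]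
    by (simp add: \<Phi>_def power2_diff mult.commute)
  define m where "m = Inf (\<Phi> ` S)"
  have bdd: "bdd_below (\<Phi> ` S)" using lower by (auto intro!: bdd_belowI[of _ "- K\<^sup>2"])
  have m_le: "m \<le> \<Phi> x" if "x \<in> S" for x
    using that bdd by (simp add: m_def cINF_lower)
  have "\<exists>x\<in>S. \<Phi> x < m + 1 / Suc k" for k :: nat
    using cInf_lessD[of "\<Phi> ` S" "m + 1 / Suc k"] zero_in by (auto simp: m_def)
  then obtain l where l: "\<And>k. l k \<in> S" "\<And>k. \<Phi> (l k) < m + 1 / Suc k" by metis
  have "(sn (l i - l k))\<^sup>2 \<le> 2 / Suc i + 2 / Suc k" for i k
  proof -
    have "\<Phi> (l i) + \<Phi> (l k) = 2 * \<Phi> (rs (1/2) (l i + l k)) + (sn (l i - l k))\<^sup>2 / 2"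
      using l sym[of "l i" "l k"]
      by (simp add: \<Phi>_def sn_sq form_simps f_add f_rs field_simps)
    moreover have "m \<le> \<Phi> (rs (1/2) (l i + l k))"
      by (intro m_le rs_in add_in l)
    ultimately show ?thesis using l(2)[of i] l(2)[of k] by simp
  qed
  moreover have "(\<lambda>k. \<beta> (l k) h) \<longlonglongrightarrow> f h" if h: "h \<in> S" for h
  proof -
    \<comment> \<open>Since \<open>\<Phi> (l k)\<close> is within \<open>1 / Suc k\<close> of the
      infimum, moving \<open>l k\<close> along \<open>h\<close> cannot lower it by more than that.
      The discriminant of this quadratic in \<open>t\<close> gives an approximate Euler-Lagrange
      equation.\<close>
    have le: "(\<beta> (l k) h - f h)\<^sup>2 \<le> \<beta> h h * (1 / Suc k)" for k
    proof (rule discriminant_le)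
      fix t
      have "m \<le> \<Phi> (l k + rs t h)" by (intro m_le rs_in add_in l h)
      also have "\<dots> = \<Phi> (l k) + 2 * (\<beta> (l k) h - f h) * t + \<beta> h h * t\<^sup>2"
        using l h sym[of "l k" h]
        by (simp add: \<Phi>_def form_simps f_add f_rs algebra_simps power2_eq_square)
      finally show "\<beta> h h * t\<^sup>2 + 2 * (\<beta> (l k) h - f h) * t + 1 / Suc k \<ge> 0"
        using l(2)[of k] by simp
    qed (simp add: nonneg h)
    have "(\<lambda>k. \<beta> h h * (1 / Suc k)) \<longlonglongrightarrow> 0"
      using tendsto_mult_right_zero[OF LIMSEQ_inverse_real_of_nat]
      by (simp add: inverse_eq_divide)
    then have "(\<lambda>k. (\<beta> (l k) h - f h)\<^sup>2) \<longlonglongrightarrow> 0"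
      by (rule Lim_null_comparison[rotated]) (simp only: real_norm_def abs_power2 le eventually_True)
    from tendsto_real_sqrt[OF this] have "(\<lambda>k. \<beta> (l k) h - f h) \<longlonglongrightarrow> 0"
      by (simp add: tendsto_rabs_zero_iff)
    then show ?thesis by (simp add: LIM_zero_iff)
  qed
  ultimately show ?thesis using l(1) that by blast
qed

end

section \<open>Hilbert space operators: adjoints, operator norm, positivity\<close>

locale hilbert =
  fixes sc :: "complex \<Rightarrow> 'x::ab_group_add \<Rightarrow> 'x" and ip :: "'x \<Rightarrow> 'x \<Rightarrow> complex"
  assumes hilbert: "hilbert_space sc ip"
begin

abbreviation N :: "'x \<Rightarrow> real" where "N \<equiv> hnorm ip"

lemma ip_add_right: "ip x (y + z) = ip x y + ip x z"
  and ip_scale_right: "ip x (sc c y) = c * ip x y"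
  and ip_cnj: "ip y x = cnj (ip x y)"
  and ip_self_nonneg: "Re (ip x x) \<ge> 0"
  and ip_self_zero: "ip x x = 0 \<Longrightarrow> x = 0"
  using hilbert unfolding hilbert_space_def by metis+

lemma ip_add_left: "ip (x + y) z = ip x z + ip y z"
  using ip_add_right[of z x y] by (metis complex_cnj_add ip_cnj)

lemma ip_scale_left: "ip (sc c x) y = cnj c * ip x y"
  using ip_scale_right[of y c x] by (metis complex_cnj_mult ip_cnj)

lemma ip_zero_right [simp]: "ip x 0 = 0"
  using ip_add_right[of x 0 0] by simp

lemma ip_zero_left [simp]: "ip 0 x = 0"
  using ip_add_left[of 0 0 x] by simp

lemma ip_diff_right: "ip x (y - z) = ip x y - ip x z"
  using ip_add_right[of x "y - z" z] by simp

lemma ip_diff_left: "ip (x - y) z = ip x z - ip y z"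
  using ip_add_left[of "x - y" y z] by simp

sublocale X: psd_form UNIV "\<lambda>r. sc (of_real r)" "\<lambda>x y. Re (ip x y)"
  rewrites "psd_form.sn (\<lambda>x y. Re (ip x y)) = hnorm ip"
    and "\<And>x. (x::'x) \<in> UNIV \<equiv> True" and "\<And>P. (True \<Longrightarrow> P) \<equiv> Trueprop P"
proof -
  show "psd_form UNIV (\<lambda>r. sc (of_real r)) (\<lambda>x y. Re (ip x y))"
    by unfold_locales
      (simp_all add: ip_add_right ip_scale_right ip_self_nonneg, metis cnj.sel(1) ip_cnj)
  then show "psd_form.sn (\<lambda>x y. Re (ip x y)) = hnorm ip"
    by (simp add: fun_eq_iff psd_form.sn_def hnorm_def)
qed simp_all

lemma N_zero_iff: "N x = 0 \<longleftrightarrow> x = 0"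
proof
  assume "N x = 0"
  moreover have "Im (ip x x) = 0" using ip_cnj[of x x] by (simp add: complex_eq_iff)
  ultimately show "x = 0" by (intro ip_self_zero) (simp add: hnorm_def complex_eq_iff)
qed (simp add: X.sn_zero)

text \<open>Testing with \<open>x = u - v\<close> yields \<open>N (u - v) = 0\<close>, so real
  parts, which are all that \<open>psd_form\<close> sees, determine a vector.\<close>

lemma ip_eqI:
  assumes "\<And>x. Re (ip x u) = Re (ip x v)"
  shows "u = v"
proof -
  have "N (u - v) = 0" using assms by (simp add: hnorm_def ip_diff_right)
  then show ?thesis by (simp add: N_zero_iff)
qed

lemma tendsto_ip_left:
  assumes "(\<lambda>k. N (l k - p)) \<longlonglongrightarrow> 0"
  shows "(\<lambda>k. Re (ip (l k) x)) \<longlonglongrightarrow> Re (ip p x)"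
proof -
  have "(\<lambda>k. N (l k - p) * N x) \<longlonglongrightarrow> 0"
    using tendsto_mult_left_zero[OF assms] .
  then have "(\<lambda>k. Re (ip (l k) x) - Re (ip p x)) \<longlonglongrightarrow> 0"
    by (rule tendsto_0_le[where K = 1])
      (use X.Cauchy_Schwarz[of "l _ - p" x] in
        \<open>auto intro!: always_eventually simp: X.diff_left X.sn_nonneg\<close>)
  then show ?thesis by (simp add: LIM_zero_iff)
qed

lemma complete:
  assumes "\<And>i k. (N (l i - l k))\<^sup>2 \<le> 2 / Suc i + 2 / Suc k"
  obtains p where "(\<lambda>k. N (l k - p)) \<longlonglongrightarrow> 0"
proof -
  have "\<exists>n0. \<forall>m\<ge>n0. \<forall>n\<ge>n0. N (l m - l n) < e" if "e > 0" for e
  proof -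
    \<comment> \<open>Beyond \<open>4 / e^2\<close>, each of the two terms of the rate, which is the
      one provided by \<open>approximate_Riesz\<close>, is below \<open>e^2 / 2\<close>.\<close>
    obtain n0 :: nat where n0: "n0 > 4 / e\<^sup>2" using reals_Archimedean2 by blast
    have "N (l m - l n) < e" if "m \<ge> n0" "n \<ge> n0" for m n
    proof (rule power2_less_imp_less)
      have "2 / real (Suc k) < e\<^sup>2 / 2" if "k \<ge> n0" for k
      proof -
        have "4 / e\<^sup>2 < real (Suc k)" using n0 that by linarith
        then show ?thesis using \<open>e > 0\<close> by (simp add: field_simps)
      qed
      from this[of m] this[of n] show "(N (l m - l n))\<^sup>2 < e\<^sup>2"
        using assms[of m n] that by simp
    qed (use \<open>e > 0\<close> in simp)
    then show ?thesis by blast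
  qed
  moreover have "complete_wrt (\<lambda>x y. N (x - y))"
    using hilbert by (simp add: hilbert_space_def)
  ultimately obtain p where "\<forall>e>0. \<exists>n0. \<forall>n\<ge>n0. N (l n - p) < e"
    unfolding complete_wrt_def by metis
  then have "(\<lambda>k. N (l k - p)) \<longlonglongrightarrow> 0"
    by (simp add: LIMSEQ_def X.sn_nonneg)
  then show ?thesis by (rule that)
qed

lemma bounded_op_add: "bounded_op sc ip T \<Longrightarrow> T (x + y) = T x + T y"
  and bounded_op_scale: "bounded_op sc ip T \<Longrightarrow> T (sc c x) = sc c (T x)"
  by (auto simp: bounded_op_def)

lemma bounded_op_diff: "bounded_op sc ip T \<Longrightarrow> T (x - y) = T x - T y"
  using bounded_op_add[of T "x - y" y] by simp

lemma bounded_op_bound: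
  assumes "bounded_op sc ip T"
  obtains K where "K \<ge> 0" and "\<And>x. N (T x) \<le> K * N x"
proof -
  obtain K where K: "\<And>x. N (T x) \<le> K * N x" using assms by (auto simp: bounded_op_def)
  show ?thesis
  proof (rule that[of "\<bar>K\<bar>"])
    show "N (T x) \<le> \<bar>K\<bar> * N x" for x
      using K[of x] mult_right_mono[OF abs_ge_self[of K] X.sn_nonneg[of x]] by linarith
  qed simp
qed

text \<open>\<open>adj\<close> is a definite description, so a representing vector must first be
  found. Approximate representers of \<open>Re (ip (T x) y)\<close> converge by completeness, and
  replacing \<open>x\<close> by \<open>sc \<i> x\<close> recovers the imaginary part.\<close>

lemma adjoint_exists:
  assumes "bounded_op sc ip T"
  shows "\<exists>s. \<forall>x. ip (T x) y = ip x s"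
proof -
  obtain K where K: "K \<ge> 0" "\<And>x. N (T x) \<le> K * N x" using bounded_op_bound[OF assms] by metis
  have "\<bar>Re (ip (T x) y)\<bar> \<le> (K * N y) * N x" for x
    using X.Cauchy_Schwarz[of "T x" y] mult_right_mono[OF K(2) X.sn_nonneg[of y], of x]
    by (simp add: ac_simps)
  then obtain l where l: "\<And>i k. (N (l i - l k))\<^sup>2 \<le> 2 / Suc i + 2 / Suc k"
      "\<And>x. (\<lambda>k. Re (ip (l k) x)) \<longlonglongrightarrow> Re (ip (T x) y)"
    using X.approximate_Riesz[of "\<lambda>x. Re (ip (T x) y)" "K * N y"] assms
    by (auto simp: bounded_op_add bounded_op_scale ip_add_left ip_scale_left)
  obtain s where s: "(\<lambda>k. N (l k - s)) \<longlonglongrightarrow> 0" using complete[OF l(1)] .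
  have re: "Re (ip (T x) y) = Re (ip x s)" for x
    using LIMSEQ_unique[OF l(2) tendsto_ip_left[OF s]] by (simp add: X.sym)
  have "ip (T x) y = ip x s" for x
    using re[of x] re[of "sc \<i> x"] assms by (simp add: complex_eq_iff bounded_op_scale ip_scale_left)
  then show ?thesis by blast
qed

lemma adj:
  assumes "bounded_op sc ip T"
  shows "ip (T x) y = ip x (adj ip T y)"
proof -
  obtain S where S: "\<And>x y. ip (T x) y = ip x (S y)" using adjoint_exists[OF assms] by metis
  have "adj ip T = S"
    unfolding adj_def
  proof (rule the_equality)
    fix S' assume "\<forall>x y. ip (T x) y = ip x (S' y)"
    then show "S' = S" using S by (metis ext ip_eqI)
  qed (use S in blast)
  then show ?thesis using S by simp
qed

lemma adj_eqI:
  assumes "bounded_op sc ip T" and "\<And>x y. ip (T x) y = ip x (S y)"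
  shows "adj ip T = S"
  using adj[OF assms(1)] assms(2) by (metis ext ip_eqI)

lemma adj_id [simp]: "adj ip (\<lambda>v. v) = (\<lambda>v. v)"
  by (rule adj_eqI) (auto simp: bounded_op_def intro: exI[of _ 1])

lemma opnorm_upper:
  assumes T: "bounded_op sc ip T" and "N x \<le> 1"
  shows "N (T x) \<le> opnorm ip T"
proof -
  obtain K where K: "K \<ge> 0" "\<And>x. N (T x) \<le> K * N x" using bounded_op_bound[OF T] by metis
  have "bdd_above {N (T x) | x. N x \<le> 1}"
    using K by (auto intro!: bdd_aboveI[of _ K] intro: order_trans[OF K(2)] simp: mult_left_le)
  then show ?thesis
    unfolding opnorm_def using \<open>N x \<le> 1\<close> by (intro cSup_upper) auto
qed

lemma opnorm_nonneg: "bounded_op sc ip T \<Longrightarrow> opnorm ip T \<ge> 0"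
  using opnorm_upper[of T 0] X.sn_nonneg[of "T 0"] X.sn_zero by simp

lemma N_le_opnorm:
  assumes T: "bounded_op sc ip T"
  shows "N (T x) \<le> opnorm ip T * N x"
proof (cases "x = 0")
  case True
  then show ?thesis using bounded_op_diff[OF T, of 0 0] by (simp add: X.sn_zero)
next
  case False
  then have pos: "N x > 0" using N_zero_iff X.sn_nonneg less_eq_real_def by metis
  define u where "u = sc (of_real (1 / N x)) x"
  have "N u \<le> 1" using pos by (simp add: u_def X.sn_rs del: of_real_divide)
  then have "N (T u) \<le> opnorm ip T" by (rule opnorm_upper[OF T])
  moreover have "N (T u) = N (T x) / N x"
    using pos by (simp add: u_def bounded_op_scale[OF T] X.sn_rs del: of_real_divide)
  ultimately show ?thesis using pos by (simp add: field_simps)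
qed

lemma opnorm_le:
  assumes "\<And>x. N (T x) \<le> c * N x" and "c \<ge> 0"
  shows "opnorm ip T \<le> c"
  unfolding opnorm_def
proof (rule cSup_least)
  show "{N (T x) | x. N x \<le> 1} \<noteq> {}" using X.sn_zero by (auto intro!: exI[of _ 0])
qed (use assms in \<open>auto intro: order_trans[OF assms(1)] simp: mult_left_le\<close>)

text \<open>Cauchy-Schwarz for the form \<open>Re (ip u (T v))\<close>, applied to
  \<open>T v\<close> and \<open>v\<close>, gives
  \<open>N (T v) ^ 4 \<le> c * N (T v) ^ 2 * Re (ip v (T v))\<close>, and a factor
  \<open>N (T v) ^ 2\<close> cancels. This replaces the usual appeal to the square root of
  \<open>T\<close>.\<close>

lemma positive_op_N_sq_le:
  assumes T: "bounded_op sc ip T" and sym: "\<And>u v. ip (T u) v = ip u (T v)"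
    and pos: "\<And>u. Re (ip u (T u)) \<ge> 0"
    and le: "\<And>u. Re (ip u (T u)) \<le> c * (N u)\<^sup>2" and "c \<ge> 0"
  shows "(N (T v))\<^sup>2 \<le> c * Re (ip v (T v))"
proof -
  interpret P: psd_form UNIV "\<lambda>r. sc (of_real r)" "\<lambda>u v. Re (ip u (T v))"
    using T pos by unfold_locales
      (simp_all add: bounded_op_add bounded_op_scale ip_add_right ip_scale_right flip: sym, metis X.sym sym)
  define n where "n = (N (T v))\<^sup>2"
  have "n\<^sup>2 \<le> Re (ip (T v) (T (T v))) * Re (ip v (T v))"
    using P.Cauchy_Schwarz_sq[of "T v" v] by (simp add: n_def X.sn_sq)
  also have "\<dots> \<le> (c * n) * Re (ip v (T v))"
    using le[of "T v"] pos by (simp add: n_def mult_right_mono)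
  finally have "n * n \<le> n * (c * Re (ip v (T v)))"
    by (simp add: power2_eq_square ac_simps)
  moreover have "n \<ge> 0" by (simp add: n_def)
  ultimately have "n = 0 \<or> n \<le> c * Re (ip v (T v))"
    by (metis less_eq_real_def mult_le_cancel_left_pos)
  then show ?thesis using pos[of v] \<open>c \<ge> 0\<close> by (auto simp: n_def)
qed

end

section \<open>Approximation of the strong closure together with adjoints\<close>

locale operator_algebra = hilbert sc ip
  for sc :: "complex \<Rightarrow> 'x::ab_group_add \<Rightarrow> 'x" and ip +
  fixes A :: "('x \<Rightarrow> 'x) set"
  assumes subalg: "cstar_subalg sc ip A"
begin

lemma bounded: "a \<in> A \<Longrightarrow> bounded_op sc ip a"
  using subalg by (auto simp: cstar_subalg_def)

lemma zero_in: "0 \<in> A"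
  and add_in: "\<lbrakk>a \<in> A; b \<in> A\<rbrakk> \<Longrightarrow> a + b \<in> A"
  and scale_in: "a \<in> A \<Longrightarrow> (\<lambda>v. sc c (a v)) \<in> A"
  using subalg by (simp_all add: cstar_subalg_def plus_fun_def zero_fun_def)

lemma subset_sot_closure: "A \<subseteq> sot_closure sc ip A"
proof
  fix a assume "a \<in> A"
  then show "a \<in> sot_closure sc ip A"
    using bounded X.sn_zero by (auto simp: sot_closure_def intro!: bexI[of _ a])
qed

text \<open>Strong approximation does not control adjoints. Since \<open>a \<mapsto> (a, a*)\<close> is real linear, the
  closest point of its range to \<open>(b, b*)\<close> can be compared with \<open>b\<close> by testing against weak
  convergence, for which taking adjoints is harmless.\<close>

lemma strong_star_approximation:
  assumes b: "b \<in> sot_closure sc ip A" and V: "finite V" and e: "e > 0"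
  obtains a where "a \<in> A" and "\<And>v. v \<in> V \<Longrightarrow> N (a v - b v) < e"
    and "\<And>v. v \<in> V \<Longrightarrow> N (adj ip a v - adj ip b v) < e"
proof -
  let ?rs = "\<lambda>(r::real) (a::'x \<Rightarrow> 'x) v. sc (of_real r) (a v)"
  define \<beta> where "\<beta> = (\<lambda>a a'. \<Sum>v\<in>V. Re (ip (a v) (a' v)) + Re (ip (adj ip a v) (adj ip a' v)))"
  define f where "f = \<beta> b"
  have bb: "bounded_op sc ip b" using b by (simp add: sot_closure_def)
  have adj_add: "adj ip (a + a') = adj ip a + adj ip a'" if "a \<in> A" "a' \<in> A" for a a'
  proof (rule adj_eqI)
    show "bounded_op sc ip (a + a')" using that by (intro bounded add_in)
  qed (simp add: ip_add_left ip_add_right adj[OF bounded[OF that(1)]] adj[OF bounded[OF that(2)]])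
  have adj_rs: "adj ip (?rs r a) = ?rs r (adj ip a)" if "a \<in> A" for r a
  proof (rule adj_eqI)
    show "bounded_op sc ip (?rs r a)" using that by (intro bounded scale_in)
  qed (simp add: ip_scale_left ip_scale_right adj[OF bounded[OF that]])
  have minus: "sc (- 1) v = - v" for v
    by (rule ip_eqI) (use ip_diff_right[of _ 0 v] in \<open>simp add: ip_scale_right\<close>)
  have f_add: "f (a + a') = f a + f a'" and \<beta>_add: "\<beta> x (a + a') = \<beta> x a + \<beta> x a'"
    if "a \<in> A" "a' \<in> A" for x a a'
    using that by (simp_all add: f_def \<beta>_def adj_add ip_add_right sum.distrib)
  have f_rs: "f (?rs r a) = r * f a" and \<beta>_rs: "\<beta> x (?rs r a) = r * \<beta> x a"
    if "a \<in> A" for x r a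
    using that by (simp_all add: f_def \<beta>_def adj_rs ip_scale_right sum_distrib_left distrib_left)
  interpret P: psd_form A ?rs \<beta>
  proof
    show "a - a' \<in> A" if "a \<in> A" "a' \<in> A" for a a'
      using add_in[OF that(1) scale_in[OF that(2), of "- 1"]] by (simp add: minus fun_diff_def plus_fun_def)
    show "\<beta> a a' = \<beta> a' a" for a a' by (simp add: \<beta>_def X.sym)
    show "\<beta> a a \<ge> 0" for a by (auto simp: \<beta>_def intro!: sum_nonneg add_nonneg_nonneg ip_self_nonneg)
  qed (auto intro: zero_in add_in scale_in \<beta>_add \<beta>_rs)
  have le_sn: "(N (a v))\<^sup>2 \<le> (P.sn a)\<^sup>2" "(N (adj ip a v))\<^sup>2 \<le> (P.sn a)\<^sup>2"
    if "a \<in> A" "v \<in> V" for a v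
  proof -
    have "(N (a v))\<^sup>2 + (N (adj ip a v))\<^sup>2 \<le> \<beta> a a"
      unfolding \<beta>_def
      using member_le_sum[OF \<open>v \<in> V\<close>, of "\<lambda>v. Re (ip (a v) (a v)) + Re (ip (adj ip a v) (adj ip a v))"] V
      by (simp add: X.sn_sq ip_self_nonneg)
    then show "(N (a v))\<^sup>2 \<le> (P.sn a)\<^sup>2" "(N (adj ip a v))\<^sup>2 \<le> (P.sn a)\<^sup>2"
      unfolding P.sn_sq[OF that(1)]
      using zero_le_power2[of "N (a v)"] zero_le_power2[of "N (adj ip a v)"] by linarith+
  qed
  have f_bound: "\<bar>f a\<bar> \<le> (\<Sum>v\<in>V. N (b v) + N (adj ip b v)) * P.sn a" if a: "a \<in> A" for a
  proof -
    have "\<bar>Re (ip (b v) (a v)) + Re (ip (adj ip b v) (adj ip a v))\<bar>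
        \<le> (N (b v) + N (adj ip b v)) * P.sn a" if v: "v \<in> V" for v
    proof -
      have "N (a v) \<le> P.sn a" "N (adj ip a v) \<le> P.sn a"
        using le_sn[OF a v] P.sn_nonneg[OF a] power2_le_imp_le by blast+
      then have "N (b v) * N (a v) \<le> N (b v) * P.sn a"
        "N (adj ip b v) * N (adj ip a v) \<le> N (adj ip b v) * P.sn a"
        by (simp_all add: mult_left_mono X.sn_nonneg)
      then show ?thesis
        using X.Cauchy_Schwarz[of "b v" "a v"] X.Cauchy_Schwarz[of "adj ip b v" "adj ip a v"]
        unfolding distrib_right by linarith
    qed
    then show ?thesis
      unfolding f_def \<beta>_def sum_distrib_right by (intro order_trans[OF sum_abs] sum_mono)
  qed
  obtain l where l_in: "\<And>k. l k \<in> A"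
    and cauchy: "\<And>i k. (P.sn (l i - l k))\<^sup>2 \<le> 2 / Suc i + 2 / Suc k"
    and riesz: "\<And>a. a \<in> A \<Longrightarrow> (\<lambda>k. \<beta> (l k) a) \<longlonglongrightarrow> f a"
    using P.approximate_Riesz[of f, OF f_add f_rs f_bound] by blast
  have adj_diff: "adj ip (a - a') v = adj ip a v - adj ip a' v" if "a \<in> A" "a' \<in> A" for a a' v
    using adj_add[OF P.diff_in[OF that] that(2)] by (simp add: fun_eq_iff)
  have "\<exists>p. (\<lambda>k. N (l k v - p)) \<longlonglongrightarrow> 0" "\<exists>q. (\<lambda>k. N (adj ip (l k) v - q)) \<longlonglongrightarrow> 0"
    if "v \<in> V" for v
  proof -
    have "(N (l i v - l k v))\<^sup>2 \<le> 2 / Suc i + 2 / Suc k"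
      "(N (adj ip (l i) v - adj ip (l k) v))\<^sup>2 \<le> 2 / Suc i + 2 / Suc k" for i k
      using le_sn[OF P.diff_in[OF l_in l_in] that, of i k] cauchy[of i k]
      by (simp_all add: adj_diff l_in)
    then show "\<exists>p. (\<lambda>k. N (l k v - p)) \<longlonglongrightarrow> 0" "\<exists>q. (\<lambda>k. N (adj ip (l k) v - q)) \<longlonglongrightarrow> 0"
      using complete by metis+
  qed
  then obtain p q where p: "\<And>v. v \<in> V \<Longrightarrow> (\<lambda>k. N (l k v - p v)) \<longlonglongrightarrow> 0"
    and q: "\<And>v. v \<in> V \<Longrightarrow> (\<lambda>k. N (adj ip (l k) v - q v)) \<longlonglongrightarrow> 0"
    by metis
  \<comment> \<open>\<open>g\<close> pairs \<open>a\<close> and its adjoint with the residuals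
    \<open>b - p\<close> and \<open>adj ip b - q\<close>. The second summand has the adjoint moved
    across, so that \<open>g a\<close> depends only on finitely many values of \<open>a\<close>
    itself.\<close>
  define g where "g = (\<lambda>a. \<Sum>v\<in>V. Re (ip (b v - p v) (a v)) + Re (ip (a (adj ip b v - q v)) v))"
  have g_A: "g a = 0" if "a \<in> A" for a
  proof -
    have "(\<lambda>k. \<beta> (l k) a) \<longlonglongrightarrow> (\<Sum>v\<in>V. Re (ip (p v) (a v)) + Re (ip (q v) (adj ip a v)))"
      unfolding \<beta>_def by (intro tendsto_sum tendsto_add tendsto_ip_left p q)
    from LIMSEQ_unique[OF this riesz[OF that]] show ?thesis
      using adj[OF bounded[OF that]]
      by (simp add: g_def f_def \<beta>_def ip_diff_left sum.distrib sum_subtractf)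
  qed
  \<comment> \<open>\<open>g\<close> vanishes on \<open>A\<close>, and strong approximants of
    \<open>b\<close> at the finitely many vectors that \<open>g\<close> uses carry this over to
    \<open>b\<close>.\<close>
  have "g b = 0"
  proof (rule ccontr)
    assume "g b \<noteq> 0"
    \<comment> \<open>The summand 1 makes \<open>C\<close> positive and the final estimate
      strict.\<close>
    define C where "C = (\<Sum>v\<in>V. N (b v - p v) + N v) + 1"
    have C: "C > 0" by (auto simp: C_def X.sn_nonneg intro!: add_nonneg_pos sum_nonneg)
    define d where "d = \<bar>g b\<bar> / C"
    have "d > 0" using \<open>g b \<noteq> 0\<close> C by (simp add: d_def)
    have sot: "\<exists>a\<in>A. \<forall>v\<in>W. N (b v - a v) < d" if "finite W" for W
      using b that \<open>d > 0\<close> by (simp add: sot_closure_def)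
    obtain a where a: "a \<in> A"
      and close: "\<And>v. v \<in> V \<union> (\<lambda>v. adj ip b v - q v) ` V \<Longrightarrow> N (b v - a v) < d"
      using sot[of "V \<union> (\<lambda>v. adj ip b v - q v) ` V"] V by auto
    have "\<bar>g b\<bar> = \<bar>g b - g a\<bar>" using g_A[OF a] by simp
    also have "\<dots> = \<bar>\<Sum>v\<in>V. Re (ip (b v - p v) (b v - a v)) +
        Re (ip (b (adj ip b v - q v) - a (adj ip b v - q v)) v)\<bar>"
      unfolding g_def by (simp add: ip_diff_left ip_diff_right sum.distrib sum_subtractf)
    also have "\<dots> \<le> (\<Sum>v\<in>V. (N (b v - p v) + N v) * d)"
    proof (intro order_trans[OF sum_abs] sum_mono)
      fix v assume v: "v \<in> V"
      let ?w = "adj ip b v - q v"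
      have "N (b v - p v) * N (b v - a v) \<le> N (b v - p v) * d"
        "N (b ?w - a ?w) * N v \<le> d * N v"
        using close[of v] close[of ?w] v by (simp_all add: mult_left_mono mult_right_mono X.sn_nonneg)
      then show "\<bar>Re (ip (b v - p v) (b v - a v)) + Re (ip (b ?w - a ?w) v)\<bar>
          \<le> (N (b v - p v) + N v) * d"
        using X.Cauchy_Schwarz[of "b v - p v" "b v - a v"] X.Cauchy_Schwarz[of "b ?w - a ?w" v]
        by (simp only: distrib_right mult.commute[of d])
    qed
    also have "\<dots> = (C - 1) * d" by (simp add: C_def sum_distrib_right)
    also have "\<dots> < C * d" using \<open>d > 0\<close> by simp
    also have "\<dots> = \<bar>g b\<bar>" using C by (simp add: d_def)
    finally show False by simp
  qed
  have g_adj: "g a = (\<Sum>v\<in>V. Re (ip (b v - p v) (a v)) + Re (ip (adj ip b v - q v) (adj ip a v)))"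
    if "bounded_op sc ip a" for a
    using adj[OF that] by (simp add: g_def)
  \<comment> \<open>The residual is orthogonal to the pair formed by \<open>b\<close> and its
    adjoint, and, in the limit along \<open>l\<close>, to the pair \<open>p\<close>,
    \<open>q\<close>. Hence it is orthogonal to itself.\<close>
  have "(\<Sum>v\<in>V. (N (b v - p v))\<^sup>2 + (N (adj ip b v - q v))\<^sup>2) = 0"
  proof -
    have "(\<lambda>k. g (l k)) \<longlonglongrightarrow>
        (\<Sum>v\<in>V. Re (ip (b v - p v) (p v)) + Re (ip (adj ip b v - q v) (q v)))"
      unfolding g_adj[OF bounded[OF l_in]] X.sym[of "_ - _"]
      by (intro tendsto_sum tendsto_add tendsto_ip_left p q)
    then have "(\<Sum>v\<in>V. Re (ip (b v - p v) (p v)) + Re (ip (adj ip b v - q v) (q v))) = 0"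
      using g_A[OF l_in] by (simp add: LIMSEQ_const_iff)
    then show ?thesis
      using \<open>g b = 0\<close> unfolding g_adj[OF bb]
      by (simp add: X.sn_sq X.diff_right sum.distrib sum_subtractf)
  qed
  then have "b v = p v" "adj ip b v = q v" if "v \<in> V" for v
    using that V by (auto simp: sum_nonneg_eq_0_iff add_nonneg_eq_0_iff N_zero_iff)
  then have "eventually (\<lambda>k. \<forall>v\<in>V. N (l k v - b v) < e \<and> N (adj ip (l k) v - adj ip b v) < e) sequentially"
    using p q e V by (auto intro!: eventually_ball_finite eventually_conj order_tendstoD(2))
  then obtain k where "\<forall>v\<in>V. N (l k v - b v) < e \<and> N (adj ip (l k) v - adj ip b v) < e"
    using eventually_happens'[OF sequentially_bot] by blast
  then show ?thesis using that l_in by blast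
qed

end

section \<open>Hilbert modules: pointwise seminorms and approximate resolvent equations\<close>

locale hmodule = hilbert sc ip
  for sc :: "complex \<Rightarrow> 'x::ab_group_add \<Rightarrow> 'x" and ip +
  fixes B :: "('x \<Rightarrow> 'x) set"
    and hsc :: "complex \<Rightarrow> 'h::ab_group_add \<Rightarrow> 'h"
    and act :: "'h \<Rightarrow> ('x \<Rightarrow> 'x) \<Rightarrow> 'h"
    and hip :: "'h \<Rightarrow> 'h \<Rightarrow> ('x \<Rightarrow> 'x)"
  assumes hmodule: "hilbert_module sc ip B hsc act hip"
    and B_bounded: "a \<in> B \<Longrightarrow> bounded_op sc ip a"
begin

lemma act_add: "a \<in> B \<Longrightarrow> act (x + y) a = act x a + act y a"
  and act_add_right: "\<lbrakk>a \<in> B; b \<in> B\<rbrakk> \<Longrightarrow> act x (\<lambda>v. a v + b v) = act x a + act x b"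
  and act_scale_right: "a \<in> B \<Longrightarrow> act x (\<lambda>v. sc c (a v)) = hsc c (act x a)"
  and hip_in [simp]: "hip x y \<in> B"
  and hip_add_right: "hip x (y + z) = (\<lambda>v. hip x y v + hip x z v)"
  and hip_scale_right: "hip x (hsc c y) = (\<lambda>v. sc c (hip x y v))"
  and hip_act_right: "a \<in> B \<Longrightarrow> hip x (act y a) = hip x y \<circ> a"
  and hip_adj: "hip y x = adj ip (hip x y)"
  and hip_positive: "positive_op ip (hip x x)"
  and hip_zeroD: "hip x x = (\<lambda>v. 0) \<Longrightarrow> x = 0"
  using hmodule unfolding hilbert_module_def by metis+

lemma hsc_add: "hsc c (x + y) = hsc c x + hsc c y"
  and hsc_add_left: "hsc (c + d) x = hsc c x + hsc d x"
  and hsc_one: "hsc 1 x = x"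
  using hmodule unfolding hilbert_module_def cvs_def by metis+

lemma hsc_diff: "hsc c (x - y) = hsc c x - hsc c y"
  using hsc_add[of c "x - y" y] by simp

lemma hip_bounded [simp]: "bounded_op sc ip (hip x y)"
  by (simp add: B_bounded)

lemma ip_hip_left: "ip (hip x y u) v = ip u (hip y x v)"
  using adj[OF hip_bounded, of x y u v] hip_adj[of y x] by simp

text \<open>If module elements are thought of as operators on \<open>X\<close>, this is the real
  inner product of \<open>x\<close> applied to \<open>v\<close> with \<open>y\<close> applied to
  \<open>v\<close>, and \<open>vsn v x\<close> is the length of \<open>x\<close> applied to
  \<open>v\<close>.\<close>

definition form :: "'x \<Rightarrow> 'h \<Rightarrow> 'h \<Rightarrow> real" where
  "form v x y = Re (ip v (hip x y v))"

definition vsn :: "'x \<Rightarrow> 'h \<Rightarrow> real" where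
  "vsn v x = sqrt (form v x x)"

sublocale F: psd_form UNIV "\<lambda>r. hsc (of_real r)" "form v"
  rewrites "psd_form.sn (form v) = vsn v"
    and "\<And>x. (x::'h) \<in> UNIV \<equiv> True" and "\<And>P. (True \<Longrightarrow> P) \<equiv> Trueprop P"
  for v
proof -
  have "form v x y = form v y x" for x y
    unfolding form_def using ip_hip_left[of y x v v] X.sym by metis
  then show "psd_form UNIV (\<lambda>r. hsc (of_real r)) (form v)"
    using hip_positive
    by unfold_locales
      (auto simp: form_def positive_op_def hip_add_right hip_scale_right ip_add_right ip_scale_right)
  then show "psd_form.sn (form v) = vsn v"
    by (simp add: fun_eq_iff psd_form.sn_def vsn_def)
qed simp_all

lemma act_diff: "a \<in> B \<Longrightarrow> act (x - y) a = act x a - act y a"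
  using act_add[of a "x - y" y] by simp

lemma hip_add_left: "hip (x + y) z v = hip x z v + hip y z v"
  by (rule ip_eqI) (simp add: ip_add_right ip_add_left hip_add_right flip: ip_hip_left)

lemma hip_diff_left: "hip (x - y) z v = hip x z v - hip y z v"
  using hip_add_left[of "x - y" y z v] by simp

lemma hip_act_left: "a \<in> B \<Longrightarrow> hip (act x a) y v = adj ip a (hip x y v)"
  by (rule ip_eqI) (simp add: hip_act_right adj[OF B_bounded, symmetric] flip: ip_hip_left)

lemma act_hip_add: "act x (hip y (z + w)) = act x (hip y z) + act x (hip y w)"
  by (simp add: hip_add_right act_add_right)

lemma act_hip_diff: "act x (hip y (z - w)) = act x (hip y z) - act x (hip y w)"
  using act_hip_add[of x y "z - w" w] by simp

lemma act_hip_scale: "act x (hip y (hsc c z)) = hsc c (act x (hip y z))"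
  by (simp add: hip_scale_right act_scale_right)

lemma act_hip_zero: "act x (hip y 0) = 0"
  using act_hip_add[of x y 0 0] by simp

lemma act_hip_diff_left: "act x (hip (y - z) w) = act x (hip y w) - act x (hip z w)"
proof -
  have "hip y w = (\<lambda>v. hip (y - z) w v + hip z w v)" by (simp add: hip_diff_left)
  then have "act x (hip y w) = act x (hip (y - z) w) + act x (hip z w)"
    by (metis act_add_right hip_in)
  then show ?thesis by simp
qed

lemma form_act_right: "a \<in> B \<Longrightarrow> form v y (act x a) = Re (ip (hip x y v) (a v))"
  by (simp add: form_def hip_act_right ip_hip_left)

lemma form_act_act:
  "\<lbrakk>a \<in> B; b \<in> B\<rbrakk> \<Longrightarrow> form v (act x a) (act y b) = Re (ip (a v) (hip x y (b v)))"
  by (simp add: form_act_right hip_act_right ip_hip_left)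

lemma vsn_act: "a \<in> B \<Longrightarrow> vsn v (act x a) = vsn (a v) x"
  by (simp add: vsn_def form_act_act) (simp add: form_def)

lemma vsn_act_diff:
  assumes "a \<in> B" "b \<in> B"
  shows "vsn v (act x a - act x b) = vsn (a v - b v) x"
  using assms
  by (simp add: vsn_def F.diff_left F.diff_right form_act_act)
    (simp add: form_def bounded_op_diff[OF hip_bounded] ip_diff_left ip_diff_right)

lemma vsn_le_mnorm: "vsn v x \<le> mnorm ip hip x * N v"
proof -
  have "form v x x \<le> N v * N (hip x x v)"
    using X.Cauchy_Schwarz[of v "hip x x v"] by (simp add: form_def)
  also have "\<dots> \<le> N v * (opnorm ip (hip x x) * N v)"
    by (intro mult_left_mono N_le_opnorm) (simp_all add: X.sn_nonneg)
  finally have "vsn v x \<le> sqrt (opnorm ip (hip x x) * (N v)\<^sup>2)"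
    unfolding vsn_def by (simp add: power2_eq_square ac_simps)
  then show ?thesis by (simp add: mnorm_def real_sqrt_mult X.sn_nonneg)
qed

lemma N_hip_self_sq_le:
  assumes "\<And>u. vsn u x \<le> c * N u" and "c \<ge> 0"
  shows "(N (hip x x v))\<^sup>2 \<le> c\<^sup>2 * (vsn v x)\<^sup>2"
  unfolding F.sn_sq form_def
proof (rule positive_op_N_sq_le)
  show "Re (ip u (hip x x u)) \<le> c\<^sup>2 * (N u)\<^sup>2" for u
    using power_mono[OF assms(1) F.sn_nonneg, of u 2] by (simp add: F.sn_sq form_def power_mult_distrib)
qed (use hip_positive in \<open>simp_all add: ip_hip_left positive_op_def\<close>)

text \<open>For a norm-bounded family this turns smallness of \<open>vsn v x\<close> into smallness
  of \<open>hip x x v\<close>, the quantity that defines the topology of the theorem.\<close>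

lemma N_hip_self_le:
  assumes "\<And>u. vsn u x \<le> c * N u" and "c \<ge> 0"
  shows "N (hip x x v) \<le> c * vsn v x"
proof (rule power2_le_imp_le)
  show "(N (hip x x v))\<^sup>2 \<le> (c * vsn v x)\<^sup>2"
    using N_hip_self_sq_le[OF assms] by (simp add: power_mult_distrib)
qed (simp add: assms F.sn_nonneg)

text \<open>Together with \<open>vsn_le_mnorm\<close> this makes the module norm the least
  nonnegative constant \<open>c\<close> with \<open>vsn u x \<le> c * N u\<close> for all
  \<open>u\<close>, so norm bounds can be proved one vector at a time.\<close>

lemma mnorm_le:
  assumes "\<And>u. vsn u x \<le> c * N u" and "c \<ge> 0"
  shows "mnorm ip hip x \<le> c"
proof -
  have "N (hip x x v) \<le> c\<^sup>2 * N v" for v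
    using N_hip_self_le[OF assms] mult_left_mono[OF assms(1,2)]
    by (fastforce simp: power2_eq_square mult.assoc intro: order_trans)
  then have "opnorm ip (hip x x) \<le> c\<^sup>2" by (rule opnorm_le) simp
  then show ?thesis using assms(2) by (simp add: mnorm_def real_le_lsqrt sqrt_le_D real_sqrt_le_iff)
qed

lemma mnorm_nonneg: "mnorm ip hip x \<ge> 0"
  by (simp add: mnorm_def opnorm_nonneg)

lemma eq_zeroI:
  assumes "\<And>v. vsn v x = 0"
  shows "x = 0"
proof (rule hip_zeroD, rule ext)
  show "hip x x v = 0" for v
    using N_hip_self_le[of x 0 v] assms X.sn_nonneg[of "hip x x v"] by (simp flip: N_zero_iff)
qed

text \<open>With \<open>w = hip x y v\<close>, moving \<open>x\<close> across the inner product
  gives \<open>(N w)^2 = form v y (act x (hip x y))\<close>; Cauchy-Schwarz bounds this by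
  \<open>vsn v y * vsn w x\<close>, and a factor \<open>N w\<close> cancels.\<close>

lemma N_hip_le:
  assumes "\<And>u. vsn u x \<le> c * N u"
  shows "N (hip x y v) \<le> c * vsn v y"
proof (cases "hip x y v = 0")
  case True
  \<comment> \<open>Nonnegativity of \<open>c\<close> is not assumed; any nonzero vector forces
    it.\<close>
  have "c \<ge> 0" if "N u \<noteq> 0" for u
    using order_trans[OF F.sn_nonneg assms, of u] X.sn_nonneg[of u] that
    by (simp add: zero_le_mult_iff)
  then have "c \<ge> 0 \<or> vsn v y = 0"
    by (cases "v = 0") (auto simp: N_zero_iff vsn_def form_def)
  then show ?thesis using True F.sn_nonneg[of v y] by (auto simp: X.sn_zero)
next
  case False
  let ?w = "hip x y v"
  have pos: "N ?w > 0" using False N_zero_iff X.sn_nonneg less_eq_real_def by metis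
  have "(N ?w)\<^sup>2 = form v y (act x (hip x y))"
    by (simp add: form_act_right X.sn_sq)
  also have "\<dots> \<le> vsn v y * vsn ?w x"
    using F.Cauchy_Schwarz[of v y "act x (hip x y)"] by (simp add: vsn_act)
  also have "\<dots> \<le> vsn v y * (c * N ?w)"
    by (intro mult_left_mono assms F.sn_nonneg)
  finally show ?thesis using pos by (simp add: power2_eq_square ac_simps)
qed

text \<open>Here \<open>x\<langle>x, d\<rangle>\<close> is absorbed because the term \<open>\<parallel>\<langle>x, d\<rangle>v\<parallel>\<^sup>2\<close> that it contributes dominates the
  last summand up to \<open>\<parallel>z\<parallel>\<^sup>2 / 4\<close>; in particular the bound is independent of the size of \<open>x\<close>.\<close>

lemma vsn_resolvent_le:
  assumes "form v d (d + act x (hip x d)) = form v d p + Re (ip z (hip x d v))"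
  shows "vsn v d \<le> vsn v p + N z / 2"
proof (rule ccontr)
  let ?w = "hip x d v"
  assume "\<not> ?thesis"
  then have gt: "vsn v d - vsn v p > N z / 2" by simp
  have "(vsn v d)\<^sup>2 + (N ?w)\<^sup>2 = form v d p + Re (ip z ?w)"
    using assms by (simp add: F.add_right form_act_right F.sn_sq X.sn_sq)
  moreover have "form v d p \<le> vsn v d * vsn v p" "Re (ip z ?w) \<le> N z * N ?w"
    using F.Cauchy_Schwarz[of v d p] X.Cauchy_Schwarz[of z ?w] by simp_all
  moreover have "N z * N ?w \<le> (N ?w)\<^sup>2 + (N z / 2)\<^sup>2"
    using zero_le_power2[of "N ?w - N z / 2"] by (simp add: power2_diff ac_simps)
  ultimately have "vsn v d * (vsn v d - vsn v p) \<le> (N z / 2)\<^sup>2"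
    by (simp add: algebra_simps power2_eq_square)
  moreover have "N z / 2 * (N z / 2) < vsn v d * (vsn v d - vsn v p)"
    using gt F.sn_nonneg[of v p] X.sn_nonneg[of z] by (intro mult_strict_mono') auto
  ultimately show False by (simp add: power2_eq_square)
qed

text \<open>One Richardson step. The operator \<open>1 + T\<close> with
  \<open>T r = x\<langle>x, r\<rangle>\<close> lies between 1 and \<open>1 + c^2 < s\<close>, so
  \<open>1 - (1 + T) / s\<close> is positive and bounded by \<open>1 - 1 / s\<close>; the proof
  checks this in the seminorm directly.\<close>

lemma resolvent_step:
  assumes "\<And>u. vsn u x \<le> c * N u" and s: "s = 2 + c\<^sup>2"
  shows "vsn v (r - hsc (of_real (1 / s)) (r + act x (hip x r))) \<le> (1 - 1 / s) * vsn v r"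
proof (rule power2_le_imp_le)
  let ?t = "act x (hip x r)"
  define a where "a = form v r r"
  define b where "b = form v r ?t"
  define e where "e = form v ?t ?t"
  have s2: "s \<ge> 2" by (simp add: s)
  have b: "b = (N (hip x r v))\<^sup>2" by (simp add: b_def form_act_right X.sn_sq)
  have "e = (vsn (hip x r v) x)\<^sup>2" by (simp add: e_def flip: F.sn_sq) (simp add: vsn_act)
  then have "e \<le> c\<^sup>2 * b"
    using power_mono[OF assms(1) F.sn_nonneg, of "hip x r v" 2] by (simp add: b power_mult_distrib)
  \<comment> \<open>The choice \<open>s = 2 + c^2\<close> turns \<open>a + 2 * b + e\<close> into at
    most \<open>a + s * b\<close>, which leaves a harmless \<open>- b / s\<close> after
    expansion.\<close>
  then have "e \<le> s * b - 2 * b" by (simp add: s algebra_simps)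
  have "(vsn v (r - hsc (of_real (1 / s)) (r + ?t)))\<^sup>2
      = a - 2 / s * (a + b) + (a + 2 * b + e) / s\<^sup>2"
  proof -
    have "(vsn v (r - hsc (of_real k) (r + ?t)))\<^sup>2 = a - 2 * k * (a + b) + k\<^sup>2 * (a + 2 * b + e)" for k
      unfolding F.sn_sq using F.sym[of v ?t r]
      by (simp add: F.form_simps a_def b_def e_def power2_eq_square algebra_simps)
    from this[of "1 / s"] show ?thesis by (simp add: power_divide del: of_real_divide)
  qed
  also have "\<dots> \<le> a - 2 / s * (a + b) + (a + s * b) / s\<^sup>2"
    using \<open>e \<le> s * b - 2 * b\<close> by (intro add_left_mono divide_right_mono) simp_all
  also have "\<dots> = (1 - 1 / s)\<^sup>2 * a - b / s"
    using s2 by (simp add: field_simps power2_eq_square)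
  also have "\<dots> \<le> (1 - 1 / s)\<^sup>2 * a" using s2 by (simp add: b)
  finally show "(vsn v (r - hsc (of_real (1 / s)) (r + ?t)))\<^sup>2 \<le> ((1 - 1 / s) * vsn v r)\<^sup>2"
    by (simp add: power_mult_distrib F.sn_sq a_def)
  show "0 \<le> (1 - 1 / s) * vsn v r" using s2 by (intro mult_nonneg_nonneg F.sn_nonneg) simp
qed

text \<open>Richardson iteration for \<open>g x\<close>, started at 0 with residual
  \<open>- (x + x)\<close>. The residual shrinks by \<open>1 - 1 / s\<close> per step, uniformly in
  \<open>v\<close>.\<close>

lemma approximate_resolvent:
  assumes "\<delta> > 0"
  obtains y where "\<And>v. vsn v (y + act x (hip x y) - (x + x)) \<le> \<delta> * N v"
proof -
  define c where "c = mnorm ip hip x"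
  have c: "vsn u x \<le> c * N u" "c \<ge> 0" for u
    using vsn_le_mnorm mnorm_nonneg by (simp_all add: c_def)
  define s where "s = 2 + c\<^sup>2"
  define res where "res y = y + act x (hip x y) - (x + x)" for y
  have s2: "s \<ge> 2" by (simp add: s_def)
  have "\<exists>y. \<forall>v. vsn v (res y) \<le> (1 - 1 / s) ^ n * (2 * c * N v)" for n
  proof (induction n)
    case 0
    have "vsn v (res 0) \<le> 2 * c * N v" for v
      using F.sn_triangle[of v x x] F.sn_minus_commute[of v 0 "x + x"] c(1)[of v]
      by (simp add: res_def act_hip_zero)
    then show ?case by (intro exI[of _ 0]) simp
  next
    case (Suc n)
    then obtain y where y: "\<And>v. vsn v (res y) \<le> (1 - 1 / s) ^ n * (2 * c * N v)" by blast
    let ?r = "res y"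
    define y' where "y' = y - hsc (of_real (1 / s)) ?r"
    \<comment> \<open>The residual is affine in \<open>y\<close>, so a correction by a multiple of
      \<open>?r\<close> changes it by the linear part applied to that multiple.\<close>
    have "res y' = ?r - hsc (of_real (1 / s)) (?r + act x (hip x ?r))"
      unfolding res_def[of y'] unfolding y'_def
      by (simp add: act_hip_diff act_hip_scale hsc_add) (simp add: res_def)
    then have "vsn v (res y') \<le> (1 - 1 / s) * vsn v ?r" for v
      using resolvent_step[OF c(1) s_def] by simp
    moreover have "(1 - 1 / s) * vsn v ?r \<le> (1 - 1 / s) ^ Suc n * (2 * c * N v)" for v
      using mult_left_mono[OF y[of v], of "1 - 1 / s"] s2 by (simp add: field_simps)
    ultimately show ?case by (meson order_trans)
  qed
  moreover obtain n where n: "(1 - 1 / s) ^ n * (2 * c) \<le> \<delta>"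
  proof -
    have "(\<lambda>n. (1 - 1 / s) ^ n * (2 * c)) \<longlonglongrightarrow> 0"
      using s2 by (intro tendsto_mult_left_zero LIMSEQ_power_zero) (simp add: field_simps)
    then have "eventually (\<lambda>n. (1 - 1 / s) ^ n * (2 * c) < \<delta>) sequentially"
      using assms by (rule order_tendstoD)
    then show ?thesis using that eventually_happens'[OF sequentially_bot] less_imp_le by blast
  qed
  ultimately obtain y where y: "\<And>v. vsn v (res y) \<le> (1 - 1 / s) ^ n * (2 * c * N v)" by blast
  have "vsn v (res y) \<le> \<delta> * N v" for v
    using y[of v] mult_right_mono[OF n X.sn_nonneg[of v]] by (simp add: ac_simps)
  then show ?thesis unfolding res_def by (rule that)
qed

text \<open>The vanishing of the left-hand vector says that 1 plus the operator
  \<open>y \<mapsto> \<eta>\<langle>\<eta>, y\<rangle>\<close> maps \<open>\<xi>\<close> to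
  \<open>\<eta> + \<eta>\<close>. It is twice the defect \<open>\<Phi> \<eta> - \<eta>\<close>,
  which decays geometrically under iteration from 0.\<close>

lemma approximate_resolvent_preimage:
  assumes \<xi>: "\<And>u. vsn u \<xi> \<le> c * N u" and c: "0 \<le> c" "c < 1" and "\<delta> > 0"
  obtains \<eta> where "\<And>v. vsn v (\<xi> + act \<eta> (hip \<eta> \<xi>) - (\<eta> + \<eta>)) \<le> \<delta> * N v"
proof -
  define \<Phi> where "\<Phi> \<eta> = hsc (of_real (1 / 2)) (\<xi> + act \<eta> (hip \<eta> \<xi>))" for \<eta>
  have vsn_half: "vsn v (hsc (of_real (1 / 2)) z) = vsn v z / 2" for v z
    by (simp add: F.sn_rs del: of_real_divide)
  have c_le: "c * N v \<le> N v" for v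
    using c mult_right_mono[of c 1 "N v"] X.sn_nonneg by simp
  \<comment> \<open>The first conjunct keeps the iterates in the unit ball, where the quadratic map
    \<open>\<Phi>\<close> contracts with constant \<open>c\<close>.\<close>
  have "\<exists>\<eta>. (\<forall>v. vsn v \<eta> \<le> N v) \<and> (\<forall>v. vsn v (\<Phi> \<eta> - \<eta>) \<le> c ^ n * N v)" for n
  proof (induction n)
    case 0
    have "act 0 (hip 0 \<xi>) = 0" using act_diff[of "hip 0 \<xi>" 0 0] by simp
    then have "vsn v (\<Phi> 0 - 0) \<le> N v" for v
      using \<xi>[of v] c_le[of v] F.sn_nonneg[of v \<xi>] by (simp add: \<Phi>_def vsn_half del: of_real_divide)
    then show ?case by (intro exI[of _ 0]) (simp add: F.sn_zero X.sn_nonneg)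
  next
    case (Suc n)
    then obtain \<eta> where \<eta>: "\<And>v. vsn v \<eta> \<le> 1 * N v"
      and d: "\<And>v. vsn v (\<Phi> \<eta> - \<eta>) \<le> c ^ n * N v" by auto
    define \<eta>' where "\<eta>' = \<Phi> \<eta>"
    have \<eta>': "vsn v \<eta>' \<le> 1 * N v" for v
    proof -
      have "vsn v (act \<eta> (hip \<eta> \<xi>)) \<le> vsn v \<xi>"
        using \<eta>[of "hip \<eta> \<xi> v"] N_hip_le[OF \<eta>, of \<xi> v] by (simp add: vsn_act)
      then have "vsn v (\<xi> + act \<eta> (hip \<eta> \<xi>)) \<le> 2 * N v"
        using F.sn_triangle[of v \<xi> "act \<eta> (hip \<eta> \<xi>)"] \<xi>[of v] c_le[of v] by linarith
      then show ?thesis by (simp add: \<eta>'_def \<Phi>_def vsn_half del: of_real_divide)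
    qed
    have "vsn v (\<Phi> \<eta>' - \<eta>') \<le> c ^ Suc n * N v" for v
    proof -
      have d': "\<And>v. vsn v (\<eta>' - \<eta>) \<le> c ^ n * N v" using d by (simp add: \<eta>'_def)
      let ?p = "act (\<eta>' - \<eta>) (hip \<eta>' \<xi>)" and ?q = "act \<eta> (hip (\<eta>' - \<eta>) \<xi>)"
      \<comment> \<open>Each of the two terms contains the increment \<open>\<eta>' - \<eta>\<close>
        once, and the factor \<open>1 / 2\<close> in \<open>\<Phi>\<close> compensates for there
        being two.\<close>
      have "act \<eta>' (hip \<eta>' \<xi>) - act \<eta> (hip \<eta> \<xi>) = ?p + ?q"
        by (simp add: act_diff act_hip_diff_left)
      then have eq: "\<Phi> \<eta>' - \<eta>' = hsc (of_real (1 / 2)) (?p + ?q)"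
        unfolding \<eta>'_def \<Phi>_def by (simp add: hsc_diff[symmetric] del: of_real_divide)
      have \<xi>': "c ^ n * vsn v \<xi> \<le> c ^ Suc n * N v"
        using mult_left_mono[OF \<xi>[of v], of "c ^ n"] c by (simp add: ac_simps)
      have "vsn v ?p \<le> c ^ n * N (hip \<eta>' \<xi> v)"
        using d'[of "hip \<eta>' \<xi> v"] by (simp add: vsn_act)
      also have "\<dots> \<le> c ^ n * vsn v \<xi>"
        using N_hip_le[OF \<eta>', of \<xi> v] c by (simp add: mult_left_mono)
      finally have p: "vsn v ?p \<le> c ^ Suc n * N v" using \<xi>' by linarith
      have "vsn v ?q \<le> N (hip (\<eta>' - \<eta>) \<xi> v)"
        using \<eta>[of "hip (\<eta>' - \<eta>) \<xi> v"] by (simp add: vsn_act)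
      also have "\<dots> \<le> c ^ n * vsn v \<xi>" by (rule N_hip_le[OF d'])
      finally have "vsn v ?q \<le> c ^ Suc n * N v" using \<xi>' by linarith
      with p show ?thesis
        unfolding eq vsn_half using F.sn_triangle[of v ?p ?q] by linarith
    qed
    with \<eta>' show ?case by auto
  qed
  moreover obtain n where n: "2 * c ^ n \<le> \<delta>"
  proof -
    have "(\<lambda>n. 2 * c ^ n) \<longlonglongrightarrow> 0"
      using c by (intro tendsto_mult_right_zero LIMSEQ_power_zero) simp
    then have "eventually (\<lambda>n. 2 * c ^ n < \<delta>) sequentially"
      using \<open>\<delta> > 0\<close> by (rule order_tendstoD)
    then show ?thesis using that eventually_happens'[OF sequentially_bot] less_imp_le by blast
  qed
  ultimately obtain \<eta> where \<eta>: "\<And>v. vsn v (\<Phi> \<eta> - \<eta>) \<le> c ^ n * N v" by blast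
  have "hsc (1 / 2) z + hsc (1 / 2) z = z" for z
    using hsc_add_left[of "1 / 2" "1 / 2" z] by (simp add: hsc_one)
  then have eq: "\<xi> + act \<eta> (hip \<eta> \<xi>) - (\<eta> + \<eta>) = (\<Phi> \<eta> - \<eta>) + (\<Phi> \<eta> - \<eta>)"
    by (simp add: \<Phi>_def algebra_simps)
  have "vsn v (\<xi> + act \<eta> (hip \<eta> \<xi>) - (\<eta> + \<eta>)) \<le> \<delta> * N v" for v
    unfolding eq using F.sn_triangle[of v "\<Phi> \<eta> - \<eta>" "\<Phi> \<eta> - \<eta>"] \<eta>[of v]
      mult_right_mono[OF n X.sn_nonneg[of v]] by simp
  then show ?thesis by (rule that)
qed

end

section \<open>The interior tensor product and approximation without norm control\<close>

locale interior_tensor_product =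
  operator_algebra sc ip A + H: hmodule sc ip A hsc act hip + K: hmodule sc ip M ksc kact kip
  for sc :: "complex \<Rightarrow> 'x::ab_group_add \<Rightarrow> 'x" and ip A M
    and hsc :: "complex \<Rightarrow> 'h::ab_group_add \<Rightarrow> 'h" and act hip
    and ksc :: "complex \<Rightarrow> 'k::ab_group_add \<Rightarrow> 'k" and kact kip +
  fixes j :: "'h \<Rightarrow> ('x \<Rightarrow> 'x) \<Rightarrow> 'k"
  assumes M: "M = sot_closure sc ip A"
    and id_in: "(\<lambda>v. v) \<in> M"
    and tensor: "interior_tensor sc ip M hip ksc kact kip j"
begin

abbreviation J :: "'h \<Rightarrow> 'k" where "J x \<equiv> j x (\<lambda>v. v)"

lemma kip_j: "\<lbrakk>a \<in> M; b \<in> M\<rbrakk> \<Longrightarrow> kip (j x a) (j y b) = adj ip a \<circ> hip x y \<circ> b"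
  and tensors_dense: "e > 0 \<Longrightarrow> \<exists>(n::nat) xs bs. (\<forall>i<n. bs i \<in> M) \<and>
         mnorm ip kip (\<xi> - (\<Sum>i<n. j (xs i) (bs i))) < e"
  using tensor unfolding interior_tensor_def by metis+

lemma kip_J: "kip (J x) (J y) = hip x y"
  by (simp add: kip_j id_in comp_def)

lemma form_J: "K.form v (J x) (J y) = H.form v x y"
  by (simp add: K.form_def H.form_def kip_J)

lemma vsn_J: "K.vsn v (J x) = H.vsn v x"
  by (simp add: K.vsn_def H.vsn_def form_J)

lemma A_subset_M: "a \<in> A \<Longrightarrow> a \<in> M"
  using subset_sot_closure M by blast

text \<open>\<open>interior_tensor\<close> prescribes only inner products of elementary tensors.
  Additivity follows because the difference has length zero at every \<open>v\<close>; compatibility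
  with scalars and with the action is obtained below in the same way.\<close>

lemma J_add: "J (x + y) = J x + J y"
proof -
  have "J (x + y) - (J x + J y) = 0"
    by (rule K.eq_zeroI) (simp add: K.vsn_def K.F.form_simps form_J H.F.form_simps)
  then show ?thesis by simp
qed

lemma J_diff: "J (x - y) = J x - J y"
  using J_add[of "x - y" y] by simp

lemma J_zero: "J 0 = 0"
  using J_diff[of 0 0] by simp

lemma J_scale: "J (hsc (of_real r) x) = ksc (of_real r) (J x)"
proof -
  have "J (hsc (of_real r) x) - ksc (of_real r) (J x) = 0"
    by (rule K.eq_zeroI) (simp add: K.vsn_def K.F.form_simps form_J H.F.form_simps)
  then show ?thesis by simp
qed

lemma J_act:
  assumes a: "a \<in> A"
  shows "J (act x a) = kact (J x) a"
proof -
  have "J (act x a) - kact (J x) a = 0"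
  proof (rule K.eq_zeroI)
    fix v
    have "K.form v (J (act x a)) (kact (J x) a) = Re (ip (hip x x (a v)) (a v))"
      using a by (simp add: K.form_act_right A_subset_M kip_J H.hip_act_right)
    moreover have "K.form v (kact (J x) a) (kact (J x) a) = Re (ip (a v) (hip x x (a v)))"
      using a by (simp add: K.form_act_act A_subset_M kip_J)
    moreover have "K.form v (J (act x a)) (J (act x a)) = Re (ip (a v) (hip x x (a v)))"
      using a by (simp add: form_J H.form_act_act)
    ultimately show "K.vsn v (J (act x a) - kact (J x) a) = 0"
      using K.F.sym[of v "J (act x a)" "kact (J x) a"] X.sym[of "a v" "hip x x (a v)"]
      by (simp add: K.vsn_def K.F.form_simps)
  qed
  then show ?thesis by simp
qed

lemma j_eq:
  assumes b: "b \<in> M"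
  shows "j x b = kact (J x) b"
proof -
  have "j x b - kact (J x) b = 0"
  proof (rule K.eq_zeroI)
    fix v
    have "K.form v (j x b) (kact (J x) b) = Re (ip (b v) (hip x x (b v)))"
      using adj[OF K.B_bounded[OF b]] by (simp add: K.form_def K.hip_act_right b kip_j id_in)
    moreover have "K.form v (kact (J x) b) (kact (J x) b) = Re (ip (b v) (hip x x (b v)))"
      using b by (simp add: K.form_act_act kip_J)
    moreover have "K.form v (j x b) (j x b) = Re (ip (b v) (hip x x (b v)))"
      using adj[OF K.B_bounded[OF b]] by (simp add: K.form_def b kip_j)
    ultimately show "K.vsn v (j x b - kact (J x) b) = 0"
      using K.F.sym[of v "j x b" "kact (J x) b"] by (simp add: K.vsn_def K.F.form_simps)
  qed
  then show ?thesis by simp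
qed

text \<open>The second condition is strong closeness of adjoints, which the first does not imply. It
  is needed for the error term \<open>x\<langle>x - \<eta>, \<xi>\<rangle>\<close>, in which
  \<open>x\<close> has no norm bound. All \<open>\<zeta>\<close> are quantified so that the notion
  passes to sums.\<close>

definition approximable :: "'k \<Rightarrow> bool" where
  "approximable \<eta> \<longleftrightarrow> (\<forall>\<zeta> V e. finite V \<longrightarrow> e > 0 \<longrightarrow>
     (\<exists>x. \<forall>v\<in>V. K.vsn v (J x - \<eta>) < e \<and> N (kip (J x - \<eta>) \<zeta> v) < e))"

lemma approximableE:
  assumes "approximable \<eta>" "finite V" "e > 0"
  obtains x where "\<And>v. v \<in> V \<Longrightarrow> K.vsn v (J x - \<eta>) < e"
    and "\<And>v. v \<in> V \<Longrightarrow> N (kip (J x - \<eta>) \<zeta> v) < e"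
  using assms unfolding approximable_def by metis

lemma approximable_zero: "approximable 0"
  unfolding approximable_def
proof (intro allI impI exI[of _ 0] ballI)
  fix \<zeta> V v and e :: real assume "e > 0"
  have "kip 0 \<zeta> v = 0" using K.hip_diff_left[of 0 0 \<zeta> v] by simp
  then show "K.vsn v (J 0 - 0) < e \<and> N (kip (J 0 - 0) \<zeta> v) < e"
    using \<open>e > 0\<close> by (simp add: J_zero K.F.sn_zero X.sn_zero)
qed

lemma approximable_add:
  assumes "approximable \<eta>" "approximable \<eta>'"
  shows "approximable (\<eta> + \<eta>')"
  unfolding approximable_def
proof (intro allI impI)
  fix \<zeta> and V :: "'x set" and e :: real assume V: "finite V" and e: "e > 0"
  obtain x where x: "\<And>v. v \<in> V \<Longrightarrow> K.vsn v (J x - \<eta>) < e / 2"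
      "\<And>v. v \<in> V \<Longrightarrow> N (kip (J x - \<eta>) \<zeta> v) < e / 2"
    using approximableE[OF assms(1) V, of "e / 2" \<zeta>] e by auto
  obtain y where y: "\<And>v. v \<in> V \<Longrightarrow> K.vsn v (J y - \<eta>') < e / 2"
      "\<And>v. v \<in> V \<Longrightarrow> N (kip (J y - \<eta>') \<zeta> v) < e / 2"
    using approximableE[OF assms(2) V, of "e / 2" \<zeta>] e by auto
  have eq: "J (x + y) - (\<eta> + \<eta>') = (J x - \<eta>) + (J y - \<eta>')" by (simp add: J_add)
  show "\<exists>x. \<forall>v\<in>V. K.vsn v (J x - (\<eta> + \<eta>')) < e \<and> N (kip (J x - (\<eta> + \<eta>')) \<zeta> v) < e"
  proof (intro exI[of _ "x + y"] ballI conjI)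
    fix v assume v: "v \<in> V"
    show "K.vsn v (J (x + y) - (\<eta> + \<eta>')) < e"
      unfolding eq using K.F.sn_triangle[of v "J x - \<eta>" "J y - \<eta>'"] x(1)[OF v] y(1)[OF v] by simp
    show "N (kip (J (x + y) - (\<eta> + \<eta>')) \<zeta> v) < e"
      unfolding eq K.hip_add_left
      using X.sn_triangle[of "kip (J x - \<eta>) \<zeta> v" "kip (J y - \<eta>') \<zeta> v"] x(2)[OF v] y(2)[OF v]
      by simp
  qed
qed

text \<open>Replacing \<open>b\<close> by \<open>a\<close> from \<open>A\<close> costs
  \<open>a - b\<close> at the vectors of \<open>V\<close> in the first condition and the adjoint of
  \<open>a - b\<close> at the vectors \<open>kip (J x) \<zeta> v\<close> in the second, which is
  what \<open>strong_star_approximation\<close> controls.\<close>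

lemma approximable_elementary:
  assumes b: "b \<in> M"
  shows "approximable (j x b)"
  unfolding approximable_def
proof (intro allI impI)
  fix \<zeta> and V :: "'x set" and e :: real assume V: "finite V" and e: "e > 0"
  define c where "c = mnorm ip kip (J x)"
  have c: "c \<ge> 0" by (simp add: c_def K.mnorm_nonneg)
  have "finite (V \<union> kip (J x) \<zeta> ` V)" "e / (c + 1) > 0" using V e c by simp_all
  then obtain a where a: "a \<in> A"
    and close: "\<And>v. v \<in> V \<union> kip (J x) \<zeta> ` V \<Longrightarrow> N (a v - b v) < e / (c + 1)"
      "\<And>v. v \<in> V \<union> kip (J x) \<zeta> ` V \<Longrightarrow> N (adj ip a v - adj ip b v) < e / (c + 1)"
    using strong_star_approximation[OF b[unfolded M]] by metis
  have eq: "J (act x a) - j x b = kact (J x) a - kact (J x) b"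
    using a b by (simp add: J_act j_eq)
  show "\<exists>y. \<forall>v\<in>V. K.vsn v (J y - j x b) < e \<and> N (kip (J y - j x b) \<zeta> v) < e"
  proof (intro exI[of _ "act x a"] ballI conjI)
    fix v assume v: "v \<in> V"
    have "K.vsn v (J (act x a) - j x b) \<le> c * N (a v - b v)"
      unfolding eq using a b K.vsn_le_mnorm[of "a v - b v" "J x"]
      by (simp add: K.vsn_act_diff A_subset_M c_def)
    also have "\<dots> \<le> c * (e / (c + 1))"
      using close(1)[of v] v c by (intro mult_left_mono) auto
    also have "\<dots> < e" using e c by (simp add: field_simps)
    finally show "K.vsn v (J (act x a) - j x b) < e" .
    have "N (kip (J (act x a) - j x b) \<zeta> v) < e / (c + 1)"
      unfolding eq using a b close(2)[of "kip (J x) \<zeta> v"] v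
      by (simp add: K.hip_diff_left K.hip_act_left A_subset_M)
    also have "\<dots> \<le> e" using e c by (simp add: field_simps)
    finally show "N (kip (J (act x a) - j x b) \<zeta> v) < e" .
  qed
qed

lemma approximable_all: "approximable \<eta>"
  unfolding approximable_def
proof (intro allI impI)
  fix \<zeta> and V :: "'x set" and e :: real assume V: "finite V" and e: "e > 0"
  \<comment> \<open>\<open>C\<close> dominates both factors that multiply the norm error of
    \<open>\<eta>'\<close>: \<open>N v\<close> in the first condition and
    \<open>vsn v \<zeta>\<close> in the second.\<close>
  define C where "C = (\<Sum>v\<in>V. N v + K.vsn v \<zeta>) + 1"
  have C: "N v \<le> C" "K.vsn v \<zeta> \<le> C" if "v \<in> V" for v
    using member_le_sum[OF that, where f = "\<lambda>v. N v + K.vsn v \<zeta>"] V X.sn_nonneg[of v] K.F.sn_nonneg[of v \<zeta>]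
    unfolding C_def by (simp add: X.sn_nonneg K.F.sn_nonneg, linarith)+
  have "C > 0" by (auto simp: C_def X.sn_nonneg K.F.sn_nonneg intro!: add_nonneg_pos sum_nonneg)
  then have "e / 2 / C > 0" using e by simp
  from tensors_dense[OF this, of \<eta>] obtain n :: nat and xs bs where bs: "\<forall>i<n. bs i \<in> M"
    and close: "mnorm ip kip (\<eta> - (\<Sum>i<n. j (xs i) (bs i))) < e / 2 / C" by blast
  define \<eta>' where "\<eta>' = (\<Sum>i<n. j (xs i) (bs i))"
  have "approximable (\<Sum>i<m. j (xs i) (bs i))" if "m \<le> n" for m
    using that by (induction m)
      (use bs in \<open>simp_all add: approximable_zero approximable_add approximable_elementary\<close>)
  then have "approximable \<eta>'" by (simp add: \<eta>'_def)
  then obtain x where x: "\<And>v. v \<in> V \<Longrightarrow> K.vsn v (J x - \<eta>') < e / 2"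
      "\<And>v. v \<in> V \<Longrightarrow> N (kip (J x - \<eta>') \<zeta> v) < e / 2"
    using approximableE[OF _ V, of \<eta>' "e / 2" \<zeta>] e by auto
  have small: "K.vsn v (\<eta> - \<eta>') \<le> e / 2 / C * N v" for v
    using K.vsn_le_mnorm[of v "\<eta> - \<eta>'"] close mult_right_mono[OF less_imp_le[OF close] X.sn_nonneg[of v]]
    by (simp add: \<eta>'_def)
  have scale: "e / 2 / C * t \<le> e / 2" if "t \<le> C" for t
    using that \<open>C > 0\<close> e by (simp add: field_simps)
  have eq: "J x - \<eta> = (J x - \<eta>') - (\<eta> - \<eta>')" by simp
  show "\<exists>x. \<forall>v\<in>V. K.vsn v (J x - \<eta>) < e \<and> N (kip (J x - \<eta>) \<zeta> v) < e"
  proof (intro exI[of _ x] ballI conjI)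
    fix v assume v: "v \<in> V"
    show "K.vsn v (J x - \<eta>) < e"
      unfolding eq using K.F.sn_triangle_diff[of v "J x - \<eta>'" "\<eta> - \<eta>'"] x(1)[OF v] small[of v]
        scale[OF C(1)[OF v]] by linarith
    show "N (kip (J x - \<eta>) \<zeta> v) < e"
      unfolding eq K.hip_diff_left[of "J x - \<eta>'"]
      using X.sn_triangle_diff[of "kip (J x - \<eta>') \<zeta> v" "kip (\<eta> - \<eta>') \<zeta> v"] x(2)[OF v]
        K.N_hip_le[OF small, of \<zeta> v] scale[OF C(2)[OF v]] by linarith
  qed
qed

section \<open>Kaplansky's argument and norm-controlled approximation\<close>

lemma strict_contraction_approximation:
  assumes \<xi>: "\<And>u. K.vsn u \<xi> \<le> c * N u" and c: "0 \<le> c" "c < 1"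
    and V: "finite V" and e: "e > 0" and \<delta>: "\<delta> > 0"
  obtains y where "\<And>v. H.vsn v y \<le> (1 + \<delta>) * N v"
    and "\<And>v. v \<in> V \<Longrightarrow> K.vsn v (J y - \<xi>) < e"
proof -
  define C where "C = (\<Sum>v\<in>V. N v) + 1"
  have C: "N v \<le> C" if "v \<in> V" for v
    using member_le_sum[OF that, where f = N] V by (simp add: C_def X.sn_nonneg)
  have "C > 0" by (auto simp: C_def X.sn_nonneg intro!: add_nonneg_pos sum_nonneg)
  \<comment> \<open>One bound serves the norm estimate, the other the accuracy: at the end five
    errors of at most \<open>e / 8\<close> and one below \<open>e / 16\<close> are added.\<close>
  define \<delta>' where "\<delta>' = min \<delta> (e / 8 / C)"
  have \<delta>': "\<delta>' > 0" "\<delta>' \<le> \<delta>" using \<delta> e \<open>C > 0\<close> by (simp_all add: \<delta>'_def)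
  have \<delta>'_le: "\<delta>' * N v \<le> e / 8" if "v \<in> V" for v
  proof -
    have "\<delta>' * N v \<le> e / 8 / C * C"
      using C[OF that] e \<open>C > 0\<close> X.sn_nonneg[of v] by (intro mult_mono) (simp_all add: \<delta>'_def)
    then show ?thesis using \<open>C > 0\<close> by simp
  qed
  obtain \<eta> where "\<And>v. K.vsn v (\<xi> + kact \<eta> (kip \<eta> \<xi>) - (\<eta> + \<eta>)) \<le> \<delta>' * N v"
    using K.approximate_resolvent_preimage[OF \<xi> c \<delta>'(1)] by blast
  moreover define q where "q = \<xi> + kact \<eta> (kip \<eta> \<xi>) - (\<eta> + \<eta>)"
  ultimately have q: "\<And>v. K.vsn v q \<le> \<delta>' * N v" by simp
  \<comment> \<open>The vectors \<open>kip \<eta> \<xi> v\<close> are included because the term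
    \<open>D\<langle>\<eta>, \<xi>\<rangle>\<close> evaluates \<open>D = J x - \<eta>\<close>
    there.\<close>
  obtain x where x: "\<And>v. v \<in> V \<union> kip \<eta> \<xi> ` V \<Longrightarrow> K.vsn v (J x - \<eta>) < e / 8"
    and z: "\<And>v. v \<in> V \<union> kip \<eta> \<xi> ` V \<Longrightarrow> N (kip (J x - \<eta>) \<xi> v) < e / 8"
    using approximableE[OF approximable_all, of "V \<union> kip \<eta> \<xi> ` V" "e / 8" \<eta> \<xi>] V e by auto
  obtain y where "\<And>v. H.vsn v (y + act x (hip x y) - (x + x)) \<le> \<delta>' * N v"
    using H.approximate_resolvent[OF \<delta>'(1)] by blast
  moreover define r where "r = y + act x (hip x y) - (x + x)"
  ultimately have r: "\<And>v. H.vsn v r \<le> \<delta>' * N v" by simp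
  show ?thesis
  proof
    fix v
    \<comment> \<open>The right-hand side \<open>x + x\<close> is read as \<open>x\<close> applied
      to \<open>v + v\<close>, so \<open>vsn_resolvent_le\<close> with \<open>z = v + v\<close>
      absorbs \<open>x\<close> and bounds \<open>y\<close> independently of its size.\<close>
    have "H.form v y (y + act x (hip x y)) = H.form v y (r + (x + x))" by (simp add: r_def)
    also have "\<dots> = H.form v y r + Re (ip (v + v) (hip x y v))"
      using H.F.sym[of v y x] by (simp add: H.form_def H.hip_add_right ip_add_right ip_add_left)
    finally have "H.vsn v y \<le> H.vsn v r + N (v + v) / 2"
      by (rule H.vsn_resolvent_le)
    also have "\<dots> \<le> \<delta>' * N v + N v"
      using r[of v] X.sn_triangle[of v v] by simp
    also have "\<dots> \<le> (1 + \<delta>) * N v"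
      using mult_right_mono[OF \<delta>'(2) X.sn_nonneg[of v]] by (simp add: algebra_simps)
    finally show "H.vsn v y \<le> (1 + \<delta>) * N v" .
  next
    fix v assume v: "v \<in> V"
    define D where "D = J x - \<eta>"
    define d where "d = J y - \<xi>"
    \<comment> \<open>\<open>p\<close> collects the errors that carry no factor \<open>x\<close>;
      the remaining one, \<open>- x\<langle>D, \<xi>\<rangle>\<close>, enters
      \<open>vsn_resolvent_le\<close> through \<open>z\<close>.\<close>
    define p where "p = (D + D) + J r - q - kact D (kip \<eta> \<xi>)"
    have "J r = J y + kact (J x) (kip (J x) (J y)) - (J x + J x)"
      by (simp add: r_def J_diff J_add J_act kip_J)
    then have eq: "d + kact (J x) (kip (J x) d) = p - kact (J x) (kip D \<xi>)"
      by (simp add: d_def p_def D_def q_def K.act_hip_diff K.act_hip_diff_left K.act_diff)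
    have "K.form v d (d + kact (J x) (kip (J x) d))
        = K.form v d p + Re (ip (0 - kip D \<xi> v) (kip (J x) d v))"
      unfolding eq using X.sym[of "kip D \<xi> v" "kip (J x) d v"]
        X.diff_left[of 0 "kip D \<xi> v" "kip (J x) d v"]
      by (simp add: K.F.diff_right K.form_act_right)
    then have "K.vsn v d \<le> K.vsn v p + N (0 - kip D \<xi> v) / 2"
      by (rule K.vsn_resolvent_le)
    also have "N (0 - kip D \<xi> v) = N (kip D \<xi> v)"
      using X.sn_minus_commute[of 0 "kip D \<xi> v"] by simp
    finally have d: "K.vsn v d \<le> K.vsn v p + N (kip D \<xi> v) / 2" .
    have "K.vsn v (kact D (kip \<eta> \<xi>)) < e / 8"
      using x[of "kip \<eta> \<xi> v"] v by (simp add: K.vsn_act D_def)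
    moreover have "K.vsn v D < e / 8" "N (kip D \<xi> v) < e / 8"
      using x[of v] z[of v] v by (simp_all add: D_def)
    moreover have "K.vsn v (J r) \<le> e / 8" "K.vsn v q \<le> e / 8"
      using r[of v] q[of v] \<delta>'_le[OF v] by (simp_all add: vsn_J)
    moreover have "K.vsn v p \<le> K.vsn v (D + D + J r - q) + K.vsn v (kact D (kip \<eta> \<xi>))"
      unfolding p_def by (rule K.F.sn_triangle_diff)
    moreover have "K.vsn v (D + D + J r - q) \<le> K.vsn v (D + D + J r) + K.vsn v q"
      by (rule K.F.sn_triangle_diff)
    moreover have "K.vsn v (D + D + J r) \<le> K.vsn v (D + D) + K.vsn v (J r)"
      by (rule K.F.sn_triangle)
    moreover have "K.vsn v (D + D) \<le> K.vsn v D + K.vsn v D"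
      by (rule K.F.sn_triangle)
    ultimately show "K.vsn v (J y - \<xi>) < e" using d e unfolding d_def by linarith
  qed
qed

text \<open>The factor \<open>m\<close> shrinks \<open>\<xi>\<close> to norm at most
  \<open>1 - \<tau>\<close>. The approximant has norm at most \<open>1 + \<tau>\<close>, and
  multiplication by \<open>k\<close> brings it to at most \<open>C\<close>, the norm of
  \<open>\<xi>\<close>. The price is \<open>\<bar>k * m - 1\<bar> \<le> 2 * \<tau>\<close>.\<close>

lemma bounded_approximation:
  assumes V: "finite V" and e: "e > 0"
  obtains y where "mnorm ip hip y \<le> mnorm ip kip \<xi>"
    and "\<And>v. v \<in> V \<Longrightarrow> K.vsn v (J y - \<xi>) < e"
proof (cases "mnorm ip kip \<xi> = 0")
  case True
  show ?thesis
  proof (rule that[of 0])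
    show "mnorm ip hip 0 \<le> mnorm ip kip \<xi>"
      unfolding True by (rule H.mnorm_le) (simp_all add: H.F.sn_zero)
    show "K.vsn v (J 0 - \<xi>) < e" for v
      using K.vsn_le_mnorm[of v \<xi>] True e K.F.sn_minus_commute[of v 0 \<xi>] by (simp add: J_zero)
  qed
next
  case False
  define C where "C = mnorm ip kip \<xi>"
  have C: "C > 0" using False K.mnorm_nonneg[of \<xi>] by (simp add: C_def)
  define D where "D = (\<Sum>v\<in>V. N v) + 1"
  have D: "N v \<le> D" if "v \<in> V" for v
    using member_le_sum[OF that, where f = N] V by (simp add: D_def X.sn_nonneg)
  have "D > 0" by (auto simp: D_def X.sn_nonneg intro!: add_nonneg_pos sum_nonneg)
  define \<tau> where "\<tau> = min (1 / 2) (e / 4 / (C * D))"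
  have \<tau>: "0 < \<tau>" "\<tau> < 1" using C \<open>D > 0\<close> e by (simp_all add: \<tau>_def)
  have \<tau>_le: "\<tau> * (C * N v) \<le> e / 4" if "v \<in> V" for v
  proof -
    have "\<tau> * (C * N v) \<le> e / 4 / (C * D) * (C * D)"
      using D[OF that] e C \<open>D > 0\<close> X.sn_nonneg[of v]
      by (intro mult_mono) (simp_all add: \<tau>_def)
    then show ?thesis using C \<open>D > 0\<close> by simp
  qed
  define m where "m = (1 - \<tau>) / C"
  define k where "k = C / (1 + \<tau>)"
  define \<xi>' where "\<xi>' = ksc (of_real m) \<xi>"
  have m: "m > 0" and k: "k > 0" "k \<le> C"
    using C \<tau> by (simp_all add: m_def k_def field_simps)
  have "K.vsn u \<xi>' \<le> (1 - \<tau>) * N u" for u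
  proof -
    have "K.vsn u \<xi>' \<le> m * (C * N u)"
      using K.vsn_le_mnorm[of u \<xi>] m by (simp add: \<xi>'_def K.F.sn_rs C_def)
    then show ?thesis using C by (simp add: m_def)
  qed
  then obtain y where y: "\<And>v. H.vsn v y \<le> (1 + \<tau>) * N v"
    and close: "\<And>v. v \<in> V \<Longrightarrow> K.vsn v (J y - \<xi>') < e / (2 * C)"
    using strict_contraction_approximation[of \<xi>' "1 - \<tau>" V "e / (2 * C)" \<tau>] V e C \<tau> by auto
  show ?thesis
  proof (rule that[of "hsc (of_real k) y"])
    show "mnorm ip hip (hsc (of_real k) y) \<le> mnorm ip kip \<xi>"
    proof (rule H.mnorm_le)
      fix u
      have "H.vsn u (hsc (of_real k) y) \<le> k * ((1 + \<tau>) * N u)"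
        using y[of u] k by (simp add: H.F.sn_rs)
      then show "H.vsn u (hsc (of_real k) y) \<le> mnorm ip kip \<xi> * N u"
        using \<tau> by (simp add: k_def flip: C_def)
    qed (rule K.mnorm_nonneg)
  next
    fix v assume v: "v \<in> V"
    have eq: "J (hsc (of_real k) y) - \<xi>
        = ksc (of_real k) (J y - \<xi>') + (ksc (of_real k) \<xi>' - \<xi>)"
      by (simp add: J_scale K.hsc_diff)
    have "K.vsn v (ksc (of_real k) (J y - \<xi>')) \<le> C * K.vsn v (J y - \<xi>')"
      using k by (simp add: K.F.sn_rs mult_right_mono K.F.sn_nonneg)
    also have "\<dots> < e / 2"
      using close[OF v] C by (simp add: field_simps)
    finally have 1: "K.vsn v (ksc (of_real k) (J y - \<xi>')) < e / 2" .
    have "k * m = (1 - \<tau>) / (1 + \<tau>)" using C by (simp add: k_def m_def)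
    then have "k * m - 1 = - (2 * \<tau> / (1 + \<tau>))" using \<tau> by (simp add: field_simps)
    then have "\<bar>k * m - 1\<bar> = 2 * \<tau> / (1 + \<tau>)" using \<tau> by simp
    also have "\<dots> \<le> 2 * \<tau>" using \<tau> by (simp add: field_simps)
    finally have "K.vsn v (ksc (of_real k) \<xi>' - \<xi>) \<le> 2 * \<tau> * (C * N v)"
      unfolding \<xi>'_def K.F.sn_rs_rs_diff C_def
      by (intro mult_mono K.vsn_le_mnorm) (use \<tau> in \<open>simp_all add: K.F.sn_nonneg\<close>)
    also have "\<dots> \<le> e / 2" using \<tau>_le[OF v] by simp
    finally have "K.vsn v (ksc (of_real k) \<xi>' - \<xi>) \<le> e / 2" .
    with 1 show "K.vsn v (J (hsc (of_real k) y) - \<xi>) < e"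
      unfolding eq
      using K.F.sn_triangle[of v "ksc (of_real k) (J y - \<xi>')" "ksc (of_real k) \<xi>' - \<xi>"]
      by linarith
  qed
qed

section \<open>From finite approximation to a convergent net\<close>

lemma density_filter:
  "\<exists>F :: 'h filter. F \<noteq> bot \<and>
     eventually (\<lambda>x. mnorm ip hip x \<le> mnorm ip kip \<xi>) F \<and>
     (\<forall>v. ((\<lambda>x. N (kip (\<xi> - J x) (\<xi> - J x) v)) \<longlongrightarrow> 0) F)"
proof -
  define C where "C = mnorm ip kip \<xi>"
  \<comment> \<open>The net is encoded as the filter generated by these sets, which shrink as
    \<open>V\<close> grows and \<open>e\<close> decreases.\<close>
  define U where "U = (\<lambda>(V, e). {y. mnorm ip hip y \<le> C \<and> (\<forall>v\<in>V. K.vsn v (J y - \<xi>) < e)})"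
  define I where "I = {(V :: 'x set, e :: real). finite V \<and> e > 0}"
  define F where "F = (INF i\<in>I. principal (U i))"
  have ev: "eventually P F \<longleftrightarrow> (\<exists>i\<in>I. eventually P (principal (U i)))" for P
    unfolding F_def
  proof (rule eventually_INF_base)
    show "I \<noteq> {}" by (auto simp: I_def intro!: exI[of _ "{}"] exI[of _ 1])
    fix a b assume "a \<in> I" "b \<in> I"
    then show "\<exists>i\<in>I. principal (U i) \<le> inf (principal (U a)) (principal (U b))"
      by (intro bexI[of _ "(fst a \<union> fst b, min (snd a) (snd b))"]) (auto simp: I_def U_def)
  qed
  have "U i \<noteq> {}" if i_in: "i \<in> I" for i
  proof -
    obtain V e where i: "i = (V, e)" "finite V" "e > 0" using i_in by (auto simp: I_def)
    obtain y where "mnorm ip hip y \<le> mnorm ip kip \<xi>" "\<And>v. v \<in> V \<Longrightarrow> K.vsn v (J y - \<xi>) < e"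
      using bounded_approximation[OF i(2,3)] by metis
    then have "y \<in> U i" by (simp add: U_def C_def i(1))
    then show ?thesis by blast
  qed
  then have "F \<noteq> bot"
    using ev[of "\<lambda>_. False"] by (auto simp: trivial_limit_def eventually_principal)
  moreover have ev_C: "eventually (\<lambda>x. mnorm ip hip x \<le> C) F"
    unfolding ev by (intro bexI[of _ "({}, 1)"]) (auto simp: I_def U_def eventually_principal)
  moreover have "((\<lambda>x. N (kip (\<xi> - J x) (\<xi> - J x) v)) \<longlongrightarrow> 0) F" for v
  proof (rule tendstoI)
    fix e :: real assume e: "e > 0"
    have C: "C \<ge> 0" by (simp add: C_def K.mnorm_nonneg)
    \<comment> \<open>Since \<open>\<xi> - J x\<close> has norm at most \<open>2 * C\<close>,
      \<open>N_hip_self_le\<close> costs that factor; the summand 1 keeps the quotient defined when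
      \<open>C = 0\<close>.\<close>
    have "N (kip (\<xi> - J x) (\<xi> - J x) v) < e" if x: "x \<in> U ({v}, e / (2 * C + 1))" for x
    proof -
      have "K.vsn u (\<xi> - J x) \<le> 2 * C * N u" for u
      proof -
        have "H.vsn u x \<le> C * N u"
          using H.vsn_le_mnorm[of u x] x mult_right_mono[OF _ X.sn_nonneg[of u], of "mnorm ip hip x" C]
          by (auto simp: U_def intro: order_trans)
        then show ?thesis
          using K.F.sn_triangle_diff[of u \<xi> "J x"] K.vsn_le_mnorm[of u \<xi>]
          by (simp add: vsn_J C_def)
      qed
      then have "N (kip (\<xi> - J x) (\<xi> - J x) v) \<le> 2 * C * K.vsn v (\<xi> - J x)"
        by (rule K.N_hip_self_le) (use C in simp)
      also have "\<dots> \<le> 2 * C * (e / (2 * C + 1))"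
        using x C by (intro mult_left_mono) (auto simp: U_def K.F.sn_minus_commute[of v \<xi>])
      also have "\<dots> < e" using C e by (simp add: field_simps)
      finally show ?thesis .
    qed
    then show "eventually (\<lambda>x. dist (N (kip (\<xi> - J x) (\<xi> - J x) v)) 0 < e) F"
      unfolding ev using e C
      by (intro bexI[of _ "({v}, e / (2 * C + 1))"])
        (auto simp: I_def eventually_principal X.sn_nonneg)
  qed
  ultimately show ?thesis unfolding C_def by blast
qed

end

theorem theorem4p4:
  fixes sc :: "complex \<Rightarrow> 'x::ab_group_add \<Rightarrow> 'x"
    and ip :: "'x \<Rightarrow> 'x \<Rightarrow> complex"
    and A M :: "('x \<Rightarrow> 'x) set"
    and hsc :: "complex \<Rightarrow> 'h::ab_group_add \<Rightarrow> 'h"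
    and act :: "'h \<Rightarrow> ('x \<Rightarrow> 'x) \<Rightarrow> 'h"
    and hip :: "'h \<Rightarrow> 'h \<Rightarrow> ('x \<Rightarrow> 'x)"
    and ksc :: "complex \<Rightarrow> 'k::ab_group_add \<Rightarrow> 'k"
    and kact :: "'k \<Rightarrow> ('x \<Rightarrow> 'x) \<Rightarrow> 'k"
    and kip :: "'k \<Rightarrow> 'k \<Rightarrow> ('x \<Rightarrow> 'x)"
    and j :: "'h \<Rightarrow> ('x \<Rightarrow> 'x) \<Rightarrow> 'k"
    and \<xi> :: 'k
  assumes "hilbert_space sc ip"
    and "cstar_subalg sc ip A"
    and "M = sot_closure sc ip A"
    and "(\<lambda>v. v) \<in> M"
    and "hilbert_module sc ip A hsc act hip"
    and "interior_tensor sc ip M hip ksc kact kip j"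
  shows "\<exists>F :: 'h filter. F \<noteq> bot \<and>
           eventually (\<lambda>x. mnorm ip hip x \<le> mnorm ip kip \<xi>) F \<and>
           (\<forall>v. ((\<lambda>x. hnorm ip (kip (\<xi> - j x (\<lambda>v. v)) (\<xi> - j x (\<lambda>v. v)) v)) \<longlongrightarrow> 0) F)"
proof -
  interpret interior_tensor_product sc ip A M hsc act hip ksc kact kip j
    using assms
    by unfold_locales (auto simp: cstar_subalg_def sot_closure_def interior_tensor_def)
  show ?thesis by (rule density_filter)
qed

end
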